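(* Let $k\in L^1_{loc}(\mathbb{R}_+)$ be a nonnegative function whose Laplace transform $\widehat k(s)$ exists for all $s>0$, is a Stieltjes function, and satisfies $$\widehat{k}(s)\to 0,\ s\widehat{k}(s)\to \infty \ \text{ as } s\to \infty;\qquad \widehat{k}(s)\to \infty,\ s\widehat{k}(s)\to 0 \ \text{ as } s\to 0^+ .$$ For $\lambda\ge 0$ let $u(t;\lambda)$ and $v(t;\lambda)$ be the fundamental solution and the impulse-response solution of the relaxation equation $(\mathbb{D}_{(k)}u)(t)+\lambda u(t)=f(t)$, $t>0$, $u(0)=a$. Then there exist functions $\phi(t,\tau)$ and $\psi(t,\tau)$, $t,\tau>0$, not depending on $\lambda$, such that for all $\lambda\ge 0$ the subordination identities $$u(t;\lambda)=\int_0^\infty \phi(t,\tau)e^{-\lambda \tau}\,d\tau,\qquad v(t;\lambda)=\int_0^\infty \psi(t,\tau)e^{-\lambda \tau}\,d\tau,\qquad t>0,$$ hold, and $$\phi(t,\tau)\ge 0,\quad \psi(t,\tau)\ge 0\quad (t,\tau>0);\qquad \int_0^\infty \phi(t,\tau)\,d\tau=1\ \ (t>0),\qquad \int_0^\infty \psi(t,\tau)\,dt=1\ \ (\tau>0).$$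
   Context: Here $\mathbb{R}_+=[0,\infty)$ and $\widehat{f}(s)=\int_0^\infty e^{-st}f(t)\,dt$ denotes the Laplace transform. The general convolutional derivative is $(\mathbb{D}_{(k)} f)(t)=\frac{d}{dt}\int_0^t k(t-\tau)f(\tau)\,d\tau-k(t)f(0)$, $t>0$. A function $f$ on $(0,\infty)$ is completely monotone if it is infinitely differentiable and $(-1)^n f^{(n)}(t)\ge 0$ for all $n=0,1,\dots$ and $t>0$. A function $\varphi$ on $(0,\infty)$ is a Stieltjes function if $\varphi(s)=\frac{a}{s}+b+\int_0^\infty e^{-s\tau}\psi_0(\tau)\,d\tau$ for some $a,b\ge 0$ and some completely monotone $\psi_0$ whose Laplace transform exists for all $s>0$. The solution of the relaxation equation $(\mathbb{D}_{(k)}u)(t)+\lambda u(t)=f(t)$, $t>0$, $u(0)=a$ ($a\in\mathbb{R}$) is represented as $u(t)=a\,u(t;\lambda)+\int_0^t v(t-\tau;\lambda)f(\tau)\,d\tau$; $u(t;\lambda)$ is called the fundamental solution and $v(t;\lambda)$ the impulse-response solution. With $g(s):=s\widehat k(s)$, they are the functions, continuous for $t\ge0$ and $t>0$ respectively, determined by their Laplace transforms in $t$: $$\widehat{u}(s;\lambda)=\frac{g(s)}{s(g(s)+\lambda)},\qquad \widehat{v}(s;\lambda)=\frac{1}{g(s)+\lambda},\qquad s>0.$$ *)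

theory Defs
  imports "HOL-Analysis.Analysis"
begin

text \<open>
  Improper integrals over \<open>(0,\<infinity>)\<close> are Lebesgue integrals; a transform ``exists'' at \<open>s\<close> if the
  integrand is Lebesgue integrable. Functions on \<open>(0,\<infinity>)\<close> or \<open>[0,\<infinity>)\<close> are total functions whose
  remaining values are ignored.
\<close>

definition laplace_exists :: "(real \<Rightarrow> real) \<Rightarrow> real \<Rightarrow> bool" where
  "laplace_exists f s \<longleftrightarrow> set_integrable lebesgue {0<..} (\<lambda>t. exp (- s * t) * f t)"

definition laplace :: "(real \<Rightarrow> real) \<Rightarrow> real \<Rightarrow> real" where
  "laplace f s = (LINT t:{0<..}|lebesgue. exp (- s * t) * f t)"

definition locally_integrable_Rplus :: "(real \<Rightarrow> real) \<Rightarrow> bool" where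
  "locally_integrable_Rplus f \<longleftrightarrow> (\<forall>T\<ge>0. set_integrable lebesgue {0..T} f)"

definition completely_monotone :: "(real \<Rightarrow> real) \<Rightarrow> bool" where
  "completely_monotone f \<longleftrightarrow>
     (\<forall>n. \<forall>t>0. (deriv ^^ n) f differentiable (at t)) \<and>
     (\<forall>n. \<forall>t>0. (- 1) ^ n * (deriv ^^ n) f t \<ge> 0)"

definition stieltjes_function :: "(real \<Rightarrow> real) \<Rightarrow> bool" where
  "stieltjes_function f \<longleftrightarrow>
     (\<exists>a b \<psi>\<^sub>0. a \<ge> 0 \<and> b \<ge> 0 \<and> completely_monotone \<psi>\<^sub>0 \<and>
        (\<forall>s>0. laplace_exists \<psi>\<^sub>0 s) \<and>
        (\<forall>s>0. f s = a / s + b + laplace \<psi>\<^sub>0 s))"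

definition relaxation_symbol :: "(real \<Rightarrow> real) \<Rightarrow> real \<Rightarrow> real" where
  "relaxation_symbol k s = s * laplace k s"

text \<open>
  The solution of the relaxation equation \<open>D\<^sub>k u + l u = f\<close>, \<open>u(0) = a\<close>, where
  \<open>(D\<^sub>k u)(t) = d/dt (\<integral>\<^sub>0\<^sup>t k(t - r) u(r) dr) - k(t) u(0)\<close>, is
  \<open>a u(t;l) + \<integral>\<^sub>0\<^sup>t v(t - r;l) f(r) dr\<close>. Following the source, the fundamental solution \<open>u(\<cdot>;l)\<close> and
  the impulse-response solution \<open>v(\<cdot>;l)\<close> are the continuous functions determined by the Laplace
  transforms obtained by transforming the equation.
\<close>

definition fundamental_solution :: "(real \<Rightarrow> real) \<Rightarrow> real \<Rightarrow> (real \<Rightarrow> real) \<Rightarrow> bool" where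
  "fundamental_solution k l u \<longleftrightarrow>
     continuous_on {0..} u \<and>
     (\<forall>s>0. laplace_exists u s \<and>
        laplace u s = relaxation_symbol k s / (s * (relaxation_symbol k s + l)))"

definition impulse_response_solution :: "(real \<Rightarrow> real) \<Rightarrow> real \<Rightarrow> (real \<Rightarrow> real) \<Rightarrow> bool" where
  "impulse_response_solution k l v \<longleftrightarrow>
     continuous_on {0<..} v \<and>
     (\<forall>s>0. laplace_exists v s \<and> laplace v s = 1 / (relaxation_symbol k s + l))"

end

theory Submission
  imports Defs
begin

text \<open>
  Write \<open>K\<close> for the Laplace transform of \<open>k\<close> and \<open>g(s) = s K(s)\<close>. By the Stieltjes property and the
  limit conditions, \<open>K\<close> is the transform of a completely monotone function, which may be taken for
  \<open>k\<close>. Then \<open>g(s)\<close> is the integral of \<open>(1 - exp (- s x)) (- k'(x))\<close>, the Laplace exponent of a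
  subordinator with jump density \<open>- k'\<close>, so \<open>exp (- \<tau> g(s))\<close> is the Laplace transform of a
  probability law on the half-line for each \<open>\<tau>\<close>. If the law has the density \<open>\<psi>(\<cdot>, \<tau>)\<close>, then the
  integral of \<open>exp (- \<lambda> \<tau>) \<psi>(t, \<tau>)\<close> over \<open>\<tau>\<close> has the transform \<open>1 / (g(s) + \<lambda>)\<close> in \<open>t\<close>, which is
  that of \<open>v\<close>. In the same way \<open>\<phi>(\<cdot>, \<tau>) = k * \<psi>(\<cdot>, \<tau>)\<close> belongs to \<open>u\<close>. The integral of \<open>\<psi>\<close> over
  \<open>t\<close> is \<open>1\<close> because \<open>g\<close> vanishes at \<open>0\<close>, and the integral of \<open>\<phi>\<close> over \<open>\<tau>\<close> is \<open>u(t; 0) = 1\<close>.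

  The law is constructed from its distribution function \<open>F\<close>, the decreasing limit of the
  distribution functions of compound Poisson laws with truncated jump density
  (\<open>LT_subordinator_cdf\<close>). That it has a density comes from the derivative of its transform: with
  \<open>h(x) = - x k'(x)\<close>, whose transform is the derivative of \<open>g\<close>, one has \<open>t dF = \<tau> (h * dF)\<close>, and the
  right-hand side is a function. Division by \<open>t\<close> loses no mass since \<open>g\<close> is unbounded at infinity
  (\<open>LT_divide_ident\<close>), which means that the law has no atom at the origin.

  Uniqueness of Laplace transforms (\<open>LT_unique\<close>) gives the subordination identities for almost every
  \<open>t\<close> only. To have them for every \<open>t\<close>, the density is chosen so that it satisfies
  \<open>\<psi> = (\<tau> / t) (h * \<psi>\<^sub>0)\<close> at every point, \<open>\<psi>\<^sub>0\<close> being any version of it. As the integral of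
  \<open>\<tau> exp (- \<lambda> \<tau>) \<psi>\<^sub>0\<close> over \<open>\<tau>\<close> is almost everywhere \<open>v * v\<close>, the integral of \<open>exp (- \<lambda> \<tau>) \<psi>\<close> is
  exactly \<open>(1 / t) (h * v * v)(t)\<close>. Convolution preserves the class of functions that are
  continuous for \<open>t > 0\<close> and integrable at the origin (\<open>half_line_continuous_conv\<close>), so this is a
  continuous function of \<open>t\<close>, equal to \<open>v\<close> almost everywhere and hence everywhere. The argument for
  \<open>u = k * v\<close> is the same.
\<close>

section \<open>Laplace transforms and convolutions of nonnegative functions\<close>

text \<open>
  Nonnegative functions on the half-line are extended by zero to the whole line and take values
  in the extended nonnegative reals: integrals then always exist, and the convolution theorem is
  Tonelli's theorem together with translation invariance.
\<close>

definition LT :: "(real \<Rightarrow> ennreal) \<Rightarrow> real \<Rightarrow> ennreal" where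
  "LT f s = (\<integral>\<^sup>+t. ennreal (exp (- (s * t))) * f t \<partial>lborel)"

definition conv :: "(real \<Rightarrow> ennreal) \<Rightarrow> (real \<Rightarrow> ennreal) \<Rightarrow> real \<Rightarrow> ennreal" where
  "conv f g t = (\<integral>\<^sup>+x. f x * g (t - x) \<partial>lborel)"

lemma conv_measurable [measurable (raw)]:
  assumes [measurable]: "f \<in> borel_measurable borel" "g \<in> borel_measurable borel"
  shows "conv f g \<in> borel_measurable borel"
  unfolding conv_def by measurable

lemma nn_integral_translate:
  fixes f :: "real \<Rightarrow> ennreal"
  assumes "f \<in> borel_measurable borel"
  shows "(\<integral>\<^sup>+x. f (c + x) \<partial>lborel) = (\<integral>\<^sup>+x. f x \<partial>lborel)"
  using nn_integral_real_affine[OF assms, of 1 c] by simp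

lemma nn_integral_reflect:
  fixes f :: "real \<Rightarrow> ennreal"
  assumes "f \<in> borel_measurable borel"
  shows "(\<integral>\<^sup>+x. f (c - x) \<partial>lborel) = (\<integral>\<^sup>+x. f x \<partial>lborel)"
  using nn_integral_real_affine[OF assms, of "-1" c] by simp

lemma LT_translate:
  assumes [measurable]: "f \<in> borel_measurable borel"
  shows "LT (\<lambda>t. f (t - x)) s = ennreal (exp (- (s * x))) * LT f s"
proof -
  have "LT (\<lambda>t. f (t - x)) s = (\<integral>\<^sup>+t. ennreal (exp (- (s * (x + t)))) * f (x + t - x) \<partial>lborel)"
    unfolding LT_def by (rule nn_integral_translate[symmetric]) measurable
  also have "\<dots> = (\<integral>\<^sup>+t. ennreal (exp (- (s * x))) * (ennreal (exp (- (s * t))) * f t) \<partial>lborel)"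
    by (intro nn_integral_cong)
      (simp add: ennreal_mult' [symmetric] exp_add [symmetric] algebra_simps flip: mult.assoc)
  also have "\<dots> = ennreal (exp (- (s * x))) * LT f s"
    unfolding LT_def by (rule nn_integral_cmult) measurable
  finally show ?thesis .
qed

lemma LT_nn_integral:
  fixes f :: "real \<Rightarrow> real \<Rightarrow> ennreal"
  assumes [measurable]: "(\<lambda>(x, t). f x t) \<in> borel_measurable (borel \<Otimes>\<^sub>M borel)"
  shows "LT (\<lambda>t. \<integral>\<^sup>+x. f x t \<partial>lborel) s = (\<integral>\<^sup>+x. LT (f x) s \<partial>lborel)"
proof -
  have "LT (\<lambda>t. \<integral>\<^sup>+x. f x t \<partial>lborel) s
      = (\<integral>\<^sup>+t. \<integral>\<^sup>+x. ennreal (exp (- (s * t))) * f x t \<partial>lborel \<partial>lborel)"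
    unfolding LT_def by (intro nn_integral_cong nn_integral_cmult[symmetric]) measurable
  also have "\<dots> = (\<integral>\<^sup>+x. \<integral>\<^sup>+t. ennreal (exp (- (s * t))) * f x t \<partial>lborel \<partial>lborel)"
    by (rule lborel_pair.Fubini') measurable
  finally show ?thesis unfolding LT_def .
qed

lemma LT_cmult:
  assumes [measurable]: "f \<in> borel_measurable borel"
  shows "LT (\<lambda>t. c * f t) s = c * LT f s"
  unfolding LT_def by (subst nn_integral_cmult[symmetric]) (auto simp: ac_simps)

lemma LT_multc:
  assumes [measurable]: "f \<in> borel_measurable borel"
  shows "LT (\<lambda>t. f t * c) s = LT f s * c"
  using LT_cmult[of f c s] by (simp add: mult.commute)

lemma LT_add:
  assumes [measurable]: "f \<in> borel_measurable borel" "g \<in> borel_measurable borel"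
  shows "LT (\<lambda>t. f t + g t) s = LT f s + LT g s"
  unfolding LT_def by (simp add: distrib_left nn_integral_add)

lemma LT_cong_AE:
  assumes "AE t in lborel. f t = g t"
  shows "LT f s = LT g s"
  unfolding LT_def using assms by (intro nn_integral_cong_AE) auto

lemma LT_conv:
  assumes [measurable]: "f \<in> borel_measurable borel" "g \<in> borel_measurable borel"
  shows "LT (conv f g) s = LT f s * LT g s"
proof -
  have "LT (conv f g) s = (\<integral>\<^sup>+x. LT (\<lambda>t. f x * g (t - x)) s \<partial>lborel)"
    unfolding conv_def by (rule LT_nn_integral) measurable
  also have "\<dots> = (\<integral>\<^sup>+x. (ennreal (exp (- (s * x))) * f x) * LT g s \<partial>lborel)"
    by (intro nn_integral_cong) (simp add: LT_cmult LT_translate ac_simps)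
  also have "\<dots> = LT f s * LT g s"
    unfolding LT_def by (rule nn_integral_multc) measurable
  finally show ?thesis .
qed

lemma conv_commute:
  assumes [measurable]: "f \<in> borel_measurable borel" "g \<in> borel_measurable borel"
  shows "conv f g t = conv g f t"
proof -
  have "conv f g t = (\<integral>\<^sup>+x. f (t - x) * g (t - (t - x)) \<partial>lborel)"
    unfolding conv_def by (rule nn_integral_reflect[symmetric]) measurable
  then show ?thesis unfolding conv_def by (simp add: mult.commute)
qed

lemma conv_cong_AE:
  assumes [measurable]: "f \<in> borel_measurable borel" "g \<in> borel_measurable borel"
    "g' \<in> borel_measurable borel"
    and "AE t in lborel. g t = g' t"
  shows "conv f g t = conv f g' t"
proof -
  have "conv g f t = conv g' f t"
    unfolding conv_def using assms(4) by (intro nn_integral_cong_AE) auto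
  then show ?thesis using conv_commute assms by metis
qed

lemma conv_eq_0:
  assumes "\<And>t. t \<le> 0 \<Longrightarrow> f t = 0" "\<And>t. t < 0 \<Longrightarrow> g t = 0" "t \<le> 0"
  shows "conv f g t = 0"
proof -
  have "f x * g (t - x) = 0" for x
    using assms by (cases "x \<le> 0") auto
  then show ?thesis unfolding conv_def by (simp del: mult_eq_0_iff)
qed

lemma conv_nn_integral:
  fixes g :: "real \<Rightarrow> real \<Rightarrow> ennreal"
  assumes [measurable]: "f \<in> borel_measurable borel"
    "(\<lambda>(y, t). g y t) \<in> borel_measurable (borel \<Otimes>\<^sub>M borel)"
  shows "conv f (\<lambda>t. \<integral>\<^sup>+y. g y t \<partial>lborel) t = (\<integral>\<^sup>+y. conv f (g y) t \<partial>lborel)"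
proof -
  have "conv f (\<lambda>t. \<integral>\<^sup>+y. g y t \<partial>lborel) t
      = (\<integral>\<^sup>+x. \<integral>\<^sup>+y. f x * g y (t - x) \<partial>lborel \<partial>lborel)"
    unfolding conv_def by (intro nn_integral_cong nn_integral_cmult[symmetric]) measurable
  also have "\<dots> = (\<integral>\<^sup>+y. \<integral>\<^sup>+x. f x * g y (t - x) \<partial>lborel \<partial>lborel)"
    by (rule lborel_pair.Fubini') measurable
  finally show ?thesis unfolding conv_def .
qed

lemma conv_cmult:
  assumes [measurable]: "f \<in> borel_measurable borel" "g \<in> borel_measurable borel"
  shows "conv f (\<lambda>t. c * g t) t = c * conv f g t"
  unfolding conv_def by (subst nn_integral_cmult[symmetric]) (auto simp: ac_simps)

section \<open>Uniqueness of Laplace transforms\<close>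

lemma LT_finite_measure:
  assumes [measurable]: "f \<in> borel_measurable borel" and "LT f 1 < \<infinity>"
  shows "finite_measure (density lborel (\<lambda>t. ennreal (exp (- t)) * f t))"
  using assms(2) by (intro finite_measureI) (auto simp: emeasure_density LT_def)

text \<open>
  With \<open>y = exp (- t)\<close> in \<open>[0, 1]\<close>, the values of a Laplace transform at the positive integers are
  the moments of the weight \<open>exp (- t) f(t)\<close> with respect to \<open>y\<close>. By the Weierstrass approximation
  theorem the moments determine the integrals of all continuous functions of \<open>y\<close>.
\<close>

lemma LT_determines_integral:
  assumes [measurable]: "f \<in> borel_measurable borel" "g \<in> borel_measurable borel"
    and f0: "\<And>t. t < 0 \<Longrightarrow> f t = 0" and g0: "\<And>t. t < 0 \<Longrightarrow> g t = 0"
    and eq: "\<And>s. s > 0 \<Longrightarrow> LT f s = LT g s" and fin: "\<And>s. s > 0 \<Longrightarrow> LT f s < \<infinity>"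
    and q: "continuous_on {0..1} (q :: real \<Rightarrow> real)"
  defines "M \<equiv> density lborel (\<lambda>t. ennreal (exp (- t)) * f t)"
    and "N \<equiv> density lborel (\<lambda>t. ennreal (exp (- t)) * g t)"
  assumes qM: "q \<in> borel_measurable borel"
  shows "(\<integral>t. q (exp (- t)) \<partial>M) = (\<integral>t. q (exp (- t)) \<partial>N)"
proof -
  have aux: "(AE t in density lborel (\<lambda>t. ennreal (exp (- t)) * h t). 0 \<le> t)
     \<and> finite_measure (density lborel (\<lambda>t. ennreal (exp (- t)) * h t))
     \<and> (\<forall>n. (\<integral>t. exp (- t) ^ n \<partial>density lborel (\<lambda>t. ennreal (exp (- t)) * h t))
          = enn2real (LT h (Suc n)))"
    if [measurable]: "h \<in> borel_measurable borel" and h0: "\<And>t. t < 0 \<Longrightarrow> h t = 0"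
      and hf: "\<And>s. s > 0 \<Longrightarrow> LT h s < \<infinity>" for h :: "real \<Rightarrow> ennreal"
  proof (intro conjI allI)
    show "AE t in density lborel (\<lambda>t. ennreal (exp (- t)) * h t). 0 \<le> t"
    proof (subst AE_density)
      show "AE t in lborel. 0 < ennreal (exp (- t)) * h t \<longrightarrow> 0 \<le> t"
        by (intro AE_I2 impI, rule ccontr) (simp add: h0 not_le)
    qed measurable
    show "finite_measure (density lborel (\<lambda>t. ennreal (exp (- t)) * h t))"
      using hf by (intro LT_finite_measure) auto
    fix n
    have "(\<integral>t. exp (- t) ^ n \<partial>density lborel (\<lambda>t. ennreal (exp (- t)) * h t))
      = enn2real (\<integral>\<^sup>+t. ennreal (exp (- t) ^ n) \<partial>density lborel (\<lambda>t. ennreal (exp (- t)) * h t))"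
      by (rule integral_eq_nn_integral) auto
    also have "(\<integral>\<^sup>+t. ennreal (exp (- t) ^ n) \<partial>density lborel (\<lambda>t. ennreal (exp (- t)) * h t))
       = (\<integral>\<^sup>+t. (ennreal (exp (- t)) * h t) * ennreal (exp (- t) ^ n) \<partial>lborel)"
      by (rule nn_integral_density) measurable
    also have "\<dots> = LT h (Suc n)"
      unfolding LT_def
      by (intro nn_integral_cong)
        (simp add: ennreal_mult'[symmetric] exp_add[symmetric] exp_of_nat_mult[symmetric]
          algebra_simps flip: mult.assoc)
    finally show "(\<integral>t. exp (- t) ^ n \<partial>density lborel (\<lambda>t. ennreal (exp (- t)) * h t))
          = enn2real (LT h (Suc n))" .
  qed
  have fin': "LT g s < \<infinity>" if "s > 0" for s using eq fin that by metis
  have M: "AE t in M. 0 \<le> t" "finite_measure M"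
      "(\<integral>t. exp (- t) ^ n \<partial>M) = enn2real (LT f (Suc n))" for n
    using aux[of f] f0 fin unfolding M_def by auto
  have N: "AE t in N. 0 \<le> t" "finite_measure N"
      "(\<integral>t. exp (- t) ^ n \<partial>N) = enn2real (LT f (Suc n))" for n
    using aux[of g] g0 fin' eq[of "Suc n"] unfolding N_def by auto
  interpret M: finite_measure M by fact
  interpret N: finite_measure N by fact
  have sets[measurable_cong]: "sets M = sets borel" "sets N = sets borel"
    unfolding M_def N_def by auto
  define c where "c = measure M (space M) + measure N (space N) + 1"
  have c: "c > 0" unfolding c_def using measure_nonneg[of M "space M"] measure_nonneg[of N "space N"] by linarith
  obtain B where B: "\<And>y. y \<in> {0..1} \<Longrightarrow> \<bar>q y\<bar> \<le> B"
    using compact_imp_bounded[OF compact_continuous_image[OF q compact_Icc]]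
    unfolding bounded_iff by fastforce
  have int: "integrable K (\<lambda>t. r (exp (- t)))"
    if "finite_measure K" "sets K = sets borel" "AE t in K. 0 \<le> t" "r \<in> borel_measurable borel"
      "\<And>y. y \<in> {0..1} \<Longrightarrow> \<bar>r y\<bar> \<le> C" for K and r :: "real \<Rightarrow> real" and C
  proof -
    interpret K: finite_measure K by fact
    note that(2)[measurable_cong] that(4)[measurable]
    show ?thesis
      by (rule K.integrable_const_bound[where B = C]) (use that(3,5) in \<open>auto elim!: AE_mp\<close>)
  qed
  show ?thesis
  proof (rule ccontr)
    assume ne: "\<not> ?thesis"
    define e where "e = \<bar>(\<integral>t. q (exp (- t)) \<partial>M) - (\<integral>t. q (exp (- t)) \<partial>N)\<bar> / (2 * c)"
    have e: "e > 0" using ne c unfolding e_def by auto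
    obtain p where p: "real_polynomial_function p" "\<And>y. y \<in> {0..1} \<Longrightarrow> \<bar>q y - p y\<bar> < e"
      using Stone_Weierstrass_real_polynomial_function[OF compact_Icc q e] by metis
    obtain a n where pa: "p = (\<lambda>x. \<Sum>i\<le>n. a i * x ^ i)"
      using p(1) unfolding real_polynomial_function_iff_sum by auto
    have pm[measurable]: "p \<in> borel_measurable borel" unfolding pa by measurable
    note qM[measurable]
    have pw: "integrable K (\<lambda>t. exp (- t) ^ i)"
      if "finite_measure K" "sets K = sets borel" "AE t in K. 0 \<le> t" for K :: "real measure" and i :: nat
      by (rule int[OF that, where r = "\<lambda>y. y ^ i" and C = 1]) (auto simp: power_le_one power_abs)
    have "(\<integral>t. p (exp (- t)) \<partial>M) = (\<Sum>i\<le>n. a i * enn2real (LT f (Suc i)))"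
      unfolding pa using pw[OF M(2) sets(1) M(1)] by (simp add: M(3))
    moreover have "(\<integral>t. p (exp (- t)) \<partial>N) = (\<Sum>i\<le>n. a i * enn2real (LT f (Suc i)))"
      unfolding pa using pw[OF N(2) sets(2) N(1)] by (simp add: N(3))
    ultimately have pp: "(\<integral>t. p (exp (- t)) \<partial>M) = (\<integral>t. p (exp (- t)) \<partial>N)" by simp
    have approx: "\<bar>(\<integral>t. q (exp (- t)) \<partial>K) - (\<integral>t. p (exp (- t)) \<partial>K)\<bar> \<le> e * measure K (space K)"
      if K: "finite_measure K" "sets K = sets borel" "AE t in K. 0 \<le> t" for K
    proof -
      interpret K: finite_measure K by fact
      note K(2)[measurable_cong]
      have pb: "\<bar>p y\<bar> \<le> B + e" if "y \<in> {0..1}" for y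
        using p(2)[OF that] B[OF that] by linarith
      have iq: "integrable K (\<lambda>t. q (exp (- t)))" by (rule int[OF K qM B])
      have ip: "integrable K (\<lambda>t. p (exp (- t)))" by (rule int[OF K pm pb])
      have "\<bar>(\<integral>t. q (exp (- t)) \<partial>K) - (\<integral>t. p (exp (- t)) \<partial>K)\<bar>
          = \<bar>\<integral>t. q (exp (- t)) - p (exp (- t)) \<partial>K\<bar>"
        using iq ip by simp
      also have "\<dots> \<le> (\<integral>t. \<bar>q (exp (- t)) - p (exp (- t))\<bar> \<partial>K)"
        using integral_norm_bound[of K "\<lambda>t. q (exp (- t)) - p (exp (- t))"] by simp
      also have "\<dots> \<le> (\<integral>t. e \<partial>K)"
      proof (rule integral_mono_AE)
        show "AE t in K. \<bar>q (exp (- t)) - p (exp (- t))\<bar> \<le> e"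
          using K(3) by eventually_elim (auto intro!: less_imp_le[OF p(2)])
      qed (use iq ip in auto)
      finally show ?thesis by (simp add: mult.commute)
    qed
    have "\<bar>(\<integral>t. q (exp (- t)) \<partial>M) - (\<integral>t. q (exp (- t)) \<partial>N)\<bar>
      \<le> e * measure M (space M) + e * measure N (space N)"
      using approx[OF M(2) sets(1) M(1)] approx[OF N(2) sets(2) N(1)] pp by linarith
    also have "\<dots> \<le> e * c" using e unfolding c_def by (simp add: algebra_simps)
    also have "\<dots> = \<bar>(\<integral>t. q (exp (- t)) \<partial>M) - (\<integral>t. q (exp (- t)) \<partial>N)\<bar> / 2"
      using c unfolding e_def by (simp add: field_simps)
    finally show False using ne by simp
  qed
qed

lemma LT_unique:
  assumes [measurable]: "f \<in> borel_measurable borel" "g \<in> borel_measurable borel"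
    and f0: "\<And>t. t < 0 \<Longrightarrow> f t = 0" and g0: "\<And>t. t < 0 \<Longrightarrow> g t = 0"
    and eq: "\<And>s. s > 0 \<Longrightarrow> LT f s = LT g s" and fin: "\<And>s. s > 0 \<Longrightarrow> LT f s < \<infinity>"
  shows "AE t in lborel. f t = g t"
proof -
  define M where "M = density lborel (\<lambda>t. ennreal (exp (- t)) * f t)"
  define N where "N = density lborel (\<lambda>t. ennreal (exp (- t)) * g t)"
  interpret M: finite_measure M unfolding M_def using fin by (intro LT_finite_measure) auto
  interpret N: finite_measure N unfolding N_def using fin eq by (intro LT_finite_measure) auto
  have sets[measurable_cong]: "sets M = sets borel" "sets N = sets borel"
    unfolding M_def N_def by auto
  have "M = N"
  proof (rule measure_eqI_lessThan)
    fix x :: real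
    show "emeasure M {x<..} < \<infinity>" by (metis M.emeasure_finite infinity_ennreal_def top.not_eq_extremum)
    \<comment> \<open>Continuous ramps in \<open>y = exp (-t)\<close> that increase to the indicator of \<open>t > x\<close>.\<close>
    define q where "q j y = min 1 (max 0 (real j * (exp (- x) - y)))" for j :: nat and y :: real
    have qm[measurable]: "q j \<in> borel_measurable borel" for j unfolding q_def by measurable
    have qI: "(\<integral>t. q j (exp (- t)) \<partial>M) = (\<integral>t. q j (exp (- t)) \<partial>N)" for j
      unfolding M_def N_def
      by (rule LT_determines_integral) (use f0 g0 eq fin in \<open>auto simp: q_def intro!: continuous_intros\<close>)
    have lim: "(\<lambda>j. q j (exp (- t))) \<longlonglongrightarrow> indicator {x<..} t" for t
    proof (cases "x < t")
      case True
      then have d: "exp (- x) - exp (- t) > 0" by simp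
      obtain j0 :: nat where j0: "1 / (exp (- x) - exp (- t)) < j0" using reals_Archimedean2 by blast
      have "\<forall>\<^sub>F j in sequentially. q j (exp (- t)) = indicator {x<..} t"
        using eventually_ge_at_top[of j0]
      proof eventually_elim
        fix j assume "j0 \<le> j"
        then have "1 / (exp (- x) - exp (- t)) \<le> real j" using j0 by linarith
        then have "1 \<le> real j * (exp (- x) - exp (- t))" using d by (simp add: field_simps)
        then show "q j (exp (- t)) = indicator {x<..} t" using True unfolding q_def by simp
      qed
      then show ?thesis by (rule tendsto_eventually)
    next
      case False
      then have "real j * (exp (- x) - exp (- t)) \<le> 0" for j
        by (intro mult_nonneg_nonpos) auto
      then have "q j (exp (- t)) = 0" for j unfolding q_def
        by (simp add: max_absorb1)
      then show ?thesis using False by simp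
    qed
    have conv: "(\<lambda>j. \<integral>t. q j (exp (- t)) \<partial>K) \<longlonglongrightarrow> measure K {x<..}"
      if K: "finite_measure K" "sets K = sets borel" for K
    proof -
      interpret K: finite_measure K by fact
      note K(2)[measurable_cong]
      have "(\<lambda>j. \<integral>t. q j (exp (- t)) \<partial>K) \<longlonglongrightarrow> (\<integral>t. indicator {x<..} t \<partial>K)"
        by (rule integral_dominated_convergence[where w = "\<lambda>_. 1"])
          (use lim in \<open>auto simp: q_def\<close>)
      moreover have "{x<..} \<inter> space K = {x<..}"
        using sets_eq_imp_space_eq[OF K(2)] by auto
      ultimately show ?thesis by simp
    qed
    have "measure M {x<..} = measure N {x<..}"
      using conv[OF M.finite_measure_axioms sets(1)] conv[OF N.finite_measure_axioms sets(2)]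
      unfolding qI by (rule LIMSEQ_unique)
    then show "emeasure M {x<..} = emeasure N {x<..}"
      by (simp add: M.emeasure_eq_measure N.emeasure_eq_measure)
  qed (simp_all add: sets)
  then have "AE t in lborel. ennreal (exp (- t)) * f t = ennreal (exp (- t)) * g t"
    unfolding M_def N_def by (intro sigma_finite_measure.density_unique sigma_finite_lborel) measurable
  then show ?thesis
    by eventually_elim (simp add: ennreal_mult_cancel_left)
qed

section \<open>Compound Poisson semigroups\<close>

abbreviation step :: "real \<Rightarrow> ennreal" where
  "step \<equiv> indicator {0..}"

lemma exp_neg_mult_tendsto_0:
  assumes "(c::real) > 0"
  shows "((\<lambda>x. exp (- (c * x))) \<longlongrightarrow> 0) at_top"
  by (intro filterlim_compose[OF exp_at_bot] filterlim_compose[OF filterlim_uminus_at_bot_at_top]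
      filterlim_tendsto_pos_mult_at_top[OF tendsto_const assms filterlim_ident])

lemma nn_integral_exp_atLeast:
  assumes "(t::real) > 0"
  shows "(\<integral>\<^sup>+r. ennreal (exp (- (r * t))) * indicator {s..} r \<partial>lborel) = ennreal (exp (- (s * t)) / t)"
proof -
  have "(\<integral>\<^sup>+r. ennreal (exp (- (r * t))) * indicator {s..} r \<partial>lborel)
      = ennreal (0 - (- exp (- (s * t)) / t))"
  proof (rule nn_integral_FTC_atLeast)
    show "((\<lambda>r. - exp (- (r * t)) / t) has_real_derivative exp (- (r * t))) (at r)" for r
      using assms by (auto intro!: derivative_eq_intros simp: field_simps)
    have "((\<lambda>r. - exp (- (t * r)) / t) \<longlongrightarrow> - 0 / t) at_top"
      by (intro tendsto_intros exp_neg_mult_tendsto_0 assms) (use assms in auto)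
    then show "((\<lambda>r. - exp (- (r * t)) / t) \<longlongrightarrow> 0) at_top" by (simp add: mult.commute)
  qed auto
  then show ?thesis by simp
qed

lemma LT_step:
  assumes "s > 0"
  shows "LT step s = ennreal (1 / s)"
  using nn_integral_exp_atLeast[OF assms, of 0] unfolding LT_def by (simp add: mult.commute)

lemma suminf_exp_ennreal:
  assumes "x \<ge> 0"
  shows "(\<Sum>n. ennreal (x ^ n / fact n)) = ennreal (exp x)"
proof -
  have "(\<lambda>n. x ^ n / fact n) sums exp x"
    using exp_converges[of x] by (simp add: divide_inverse_commute)
  then have "summable (\<lambda>n. x ^ n / fact n)" "(\<Sum>n. x ^ n / fact n) = exp x"
    by (auto simp only: sums_iff)
  then show ?thesis using assms by (subst suminf_ennreal2) auto
qed

lemma ennreal_mult_mult: "a \<ge> 0 \<Longrightarrow> ennreal a * (ennreal b * c) = ennreal (a * b) * c"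
  by (simp add: ennreal_mult' mult.assoc)

text \<open>
  This is \<open>f\<close> convolved with the law at time \<open>\<tau>\<close> of the compound Poisson process with jump
  density \<open>\<nu>\<close>; for \<open>f = step\<close> it is the distribution function of that law.
\<close>

definition CP :: "(real \<Rightarrow> ennreal) \<Rightarrow> real \<Rightarrow> (real \<Rightarrow> ennreal) \<Rightarrow> real \<Rightarrow> ennreal" where
  "CP \<nu> \<tau> f t = ennreal (exp (- (\<tau> * enn2real (\<integral>\<^sup>+x. \<nu> x \<partial>lborel)))) *
     (\<Sum>n. ennreal (\<tau> ^ n / fact n) * (conv \<nu> ^^ n) f t)"

lemma conv_power_measurable [measurable (raw)]:
  assumes [measurable]: "\<nu> \<in> borel_measurable borel" "f \<in> borel_measurable borel"
  shows "(conv \<nu> ^^ n) f \<in> borel_measurable borel"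
proof (induction n)
  case (Suc n)
  note Suc[measurable]
  show ?case by (simp, measurable)
qed (use assms in simp)

lemma CP_measurable2 [measurable]:
  assumes [measurable]: "\<nu> \<in> borel_measurable borel" "f \<in> borel_measurable borel"
  shows "(\<lambda>(\<tau>, t). CP \<nu> \<tau> f t) \<in> borel_measurable (borel \<Otimes>\<^sub>M borel)"
proof -
  have [measurable]: "(conv \<nu> ^^ n) f \<in> borel_measurable borel" for n by measurable
  show ?thesis unfolding CP_def by measurable
qed

lemma CP_measurable [measurable (raw)]:
  assumes [measurable]: "\<nu> \<in> borel_measurable borel" "f \<in> borel_measurable borel"
  shows "CP \<nu> \<tau> f \<in> borel_measurable borel"
  unfolding CP_def by measurable

lemma LT_conv_power:
  assumes [measurable]: "\<nu> \<in> borel_measurable borel" "f \<in> borel_measurable borel"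
  shows "LT ((conv \<nu> ^^ n) f) s = LT \<nu> s ^ n * LT f s"
  by (induction n) (simp_all add: LT_conv ac_simps)

lemma LT_CP:
  assumes [measurable]: "\<nu> \<in> borel_measurable borel" "f \<in> borel_measurable borel"
    and a: "LT \<nu> s = ennreal a" "a \<ge> 0" and "\<tau> \<ge> 0"
  shows "LT (CP \<nu> \<tau> f) s
    = ennreal (exp (\<tau> * (a - enn2real (\<integral>\<^sup>+x. \<nu> x \<partial>lborel)))) * LT f s"
proof -
  define m where "m = enn2real (\<integral>\<^sup>+x. \<nu> x \<partial>lborel)"
  have "LT (\<lambda>t. \<Sum>n. ennreal (\<tau> ^ n / fact n) * (conv \<nu> ^^ n) f t) s
     = (\<integral>\<^sup>+t. (\<Sum>n. ennreal (exp (- (s * t))) * (ennreal (\<tau> ^ n / fact n) * (conv \<nu> ^^ n) f t)) \<partial>lborel)"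
    unfolding LT_def by (intro nn_integral_cong) simp
  also have "\<dots> = (\<Sum>n. LT (\<lambda>t. ennreal (\<tau> ^ n / fact n) * (conv \<nu> ^^ n) f t) s)"
    unfolding LT_def by (rule nn_integral_suminf) measurable
  also have "\<dots> = (\<Sum>n. ennreal ((\<tau> * a) ^ n / fact n) * LT f s)"
    using a(2) \<open>\<tau> \<ge> 0\<close>
    by (intro suminf_cong)
      (simp add: LT_cmult LT_conv_power a(1) ennreal_power ennreal_mult_mult power_mult_distrib)
  also have "\<dots> = ennreal (exp (\<tau> * a)) * LT f s"
    using a(2) \<open>\<tau> \<ge> 0\<close> by (subst ennreal_suminf_multc) (subst suminf_exp_ennreal, auto)
  finally have "LT (CP \<nu> \<tau> f) s = ennreal (exp (- (\<tau> * m))) * (ennreal (exp (\<tau> * a)) * LT f s)"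
    unfolding CP_def m_def[symmetric] by (subst LT_cmult) auto
  also have "\<dots> = ennreal (exp (\<tau> * (a - m))) * LT f s"
    by (simp add: ennreal_mult_mult exp_add[symmetric] right_diff_distrib)
  finally show ?thesis unfolding m_def .
qed

lemma conv_mono: "(\<And>t. f t \<le> g t) \<Longrightarrow> conv \<nu> f t \<le> conv \<nu> g t"
  unfolding conv_def by (intro nn_integral_mono mult_left_mono) auto

lemma conv_power_mono: "(\<And>t. f t \<le> g t) \<Longrightarrow> (conv \<nu> ^^ n) f t \<le> (conv \<nu> ^^ n) g t"
  by (induction n arbitrary: t) (auto intro: conv_mono)

lemma CP_mono: "(\<And>t. f t \<le> g t) \<Longrightarrow> CP \<nu> \<tau> f t \<le> CP \<nu> \<tau> g t"
  unfolding CP_def by (intro mult_left_mono suminf_le conv_power_mono) auto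

lemma mono_conv: "mono f \<Longrightarrow> mono (conv \<nu> f)"
  unfolding conv_def mono_def by (auto intro!: nn_integral_mono mult_left_mono)

lemma mono_conv_power: "mono f \<Longrightarrow> mono ((conv \<nu> ^^ n) f)"
  by (induction n) (simp_all add: mono_conv)

lemma mono_CP: "mono f \<Longrightarrow> mono (CP \<nu> \<tau> f)"
  unfolding CP_def
  by (intro monoI mult_left_mono suminf_le) (auto intro!: mult_left_mono monoD[OF mono_conv_power])

lemma CP_eq_0:
  assumes "\<And>x. x \<le> 0 \<Longrightarrow> \<nu> x = 0" "\<And>t. t < 0 \<Longrightarrow> f t = 0" "t < 0"
  shows "CP \<nu> \<tau> f t = 0"
proof -
  have "\<forall>t<0. (conv \<nu> ^^ n) f t = 0" for n
  proof (induction n)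
    case (Suc n)
    then show ?case using conv_eq_0[OF assms(1)] by simp
  qed (use assms(2) in simp)
  then show ?thesis using assms(3) unfolding CP_def by simp
qed

lemma conv_power_step_le:
  assumes [measurable]: "\<nu> \<in> borel_measurable borel" and "\<And>x. x \<le> 0 \<Longrightarrow> \<nu> x = 0"
  shows "(conv \<nu> ^^ n) step t \<le> (\<integral>\<^sup>+x. \<nu> x \<partial>lborel) ^ n * step t"
proof (induction n arbitrary: t)
  case (Suc n)
  define m where "m = (\<integral>\<^sup>+x. \<nu> x \<partial>lborel)"
  show ?case
  proof (cases "t < 0")
    case True
    have "(conv \<nu> ^^ n) step x = 0" if "x < 0" for x
      using Suc[of x] that by simp
    then show ?thesis using conv_eq_0[OF assms(2), where g = "(conv \<nu> ^^ n) step"] True by simp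
  next
    case False
    have le: "(conv \<nu> ^^ n) step x \<le> m ^ n" for x
    proof -
      have "(conv \<nu> ^^ n) step x \<le> m ^ n * step x" using Suc unfolding m_def .
      also have "\<dots> \<le> m ^ n * 1" by (intro mult_left_mono) (auto simp: indicator_def)
      finally show ?thesis by simp
    qed
    have "conv \<nu> ((conv \<nu> ^^ n) step) t \<le> (\<integral>\<^sup>+x. \<nu> x * m ^ n \<partial>lborel)"
      unfolding conv_def[of \<nu> "(conv \<nu> ^^ n) step"]
      by (intro nn_integral_mono mult_left_mono le) simp
    also have "\<dots> = m * m ^ n" unfolding m_def by (rule nn_integral_multc) measurable
    finally show ?thesis using False unfolding m_def by simp
  qed
qed simp

lemma CP_step_le:
  assumes [measurable]: "\<nu> \<in> borel_measurable borel" and "\<And>x. x \<le> 0 \<Longrightarrow> \<nu> x = 0"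
    and fin: "(\<integral>\<^sup>+x. \<nu> x \<partial>lborel) < \<infinity>" and "\<tau> \<ge> 0"
  shows "CP \<nu> \<tau> step t \<le> step t"
proof -
  define m where "m = enn2real (\<integral>\<^sup>+x. \<nu> x \<partial>lborel)"
  have m: "(\<integral>\<^sup>+x. \<nu> x \<partial>lborel) = ennreal m" "m \<ge> 0" using fin unfolding m_def by auto
  have "(\<Sum>n. ennreal (\<tau> ^ n / fact n) * (conv \<nu> ^^ n) step t)
      \<le> (\<Sum>n. ennreal ((\<tau> * m) ^ n / fact n) * step t)"
  proof (intro suminf_le)
    fix n
    have "ennreal (\<tau> ^ n / fact n) * (conv \<nu> ^^ n) step t
        \<le> ennreal (\<tau> ^ n / fact n) * (ennreal m ^ n * step t)"
      using conv_power_step_le[OF assms(1,2), of n t] unfolding m by (intro mult_left_mono) auto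
    also have "\<dots> = ennreal ((\<tau> * m) ^ n / fact n) * step t"
      using m(2) \<open>\<tau> \<ge> 0\<close>
      by (simp add: ennreal_power ennreal_mult_mult power_mult_distrib)
    finally show "ennreal (\<tau> ^ n / fact n) * (conv \<nu> ^^ n) step t
        \<le> ennreal ((\<tau> * m) ^ n / fact n) * step t" .
  qed auto
  also have "\<dots> = ennreal (exp (\<tau> * m)) * step t"
    using m(2) \<open>\<tau> \<ge> 0\<close> by (subst ennreal_suminf_multc) (subst suminf_exp_ennreal, auto)
  finally have "CP \<nu> \<tau> step t \<le> ennreal (exp (- (\<tau> * m))) * (ennreal (exp (\<tau> * m)) * step t)"
    unfolding CP_def m_def[symmetric] by (intro mult_left_mono) auto
  also have "\<dots> = step t"
    by (simp add: ennreal_mult_mult exp_add[symmetric])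
  finally show ?thesis .
qed

lemma LT_le_nn_integral:
  assumes "\<And>x. x < 0 \<Longrightarrow> f x = 0" "s \<ge> 0"
  shows "LT f s \<le> (\<integral>\<^sup>+x. f x \<partial>lborel)"
  unfolding LT_def
proof (intro nn_integral_mono)
  fix x
  show "ennreal (exp (- (s * x))) * f x \<le> f x"
  proof (cases "x < 0")
    case False
    then have "ennreal (exp (- (s * x))) * f x \<le> 1 * f x"
      using \<open>s \<ge> 0\<close> by (intro mult_right_mono) auto
    then show ?thesis by simp
  qed (use assms in simp)
qed

text \<open>
  Additional jumps only move the process to the right: the semigroup of \<open>\<nu> + \<eta>\<close> is the product
  of those of \<open>\<nu>\<close> and \<open>\<eta>\<close>, as the Laplace transforms show, and the second factor decreases
  \<open>step\<close>.
\<close>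

lemma CP_step_antimono:
  assumes [measurable]: "\<nu> \<in> borel_measurable borel" "\<eta> \<in> borel_measurable borel"
    and \<nu>0: "\<And>x. x \<le> 0 \<Longrightarrow> \<nu> x = 0" and \<eta>0: "\<And>x. x \<le> 0 \<Longrightarrow> \<eta> x = 0"
    and fin: "(\<integral>\<^sup>+x. \<nu> x \<partial>lborel) < \<infinity>" "(\<integral>\<^sup>+x. \<eta> x \<partial>lborel) < \<infinity>" and "\<tau> \<ge> 0"
  shows "AE t in lborel. CP (\<lambda>x. \<nu> x + \<eta> x) \<tau> step t \<le> CP \<nu> \<tau> step t"
proof -
  have sum: "(\<integral>\<^sup>+x. \<nu> x + \<eta> x \<partial>lborel) = (\<integral>\<^sup>+x. \<nu> x \<partial>lborel) + (\<integral>\<^sup>+x. \<eta> x \<partial>lborel)"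
    by (rule nn_integral_add) measurable
  have *: "LT (CP (\<lambda>x. \<nu> x + \<eta> x) \<tau> step) s = LT (CP \<nu> \<tau> (CP \<eta> \<tau> step)) s
     \<and> LT (CP (\<lambda>x. \<nu> x + \<eta> x) \<tau> step) s < \<infinity>" if "s > 0" for s
  proof -
    have "LT \<nu> s < \<infinity>" "LT \<eta> s < \<infinity>"
      using LT_le_nn_integral[of \<nu> s] LT_le_nn_integral[of \<eta> s] \<nu>0 \<eta>0 fin that
      by (auto intro: le_less_trans)
    then obtain a b where a: "LT \<nu> s = ennreal a" "a \<ge> 0" and b: "LT \<eta> s = ennreal b" "b \<ge> 0"
      by (metis ennreal_cases infinity_ennreal_def less_irrefl)
    obtain m n where m: "(\<integral>\<^sup>+x. \<nu> x \<partial>lborel) = ennreal m" "m \<ge> 0"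
        and n: "(\<integral>\<^sup>+x. \<eta> x \<partial>lborel) = ennreal n" "n \<ge> 0"
      using fin by (metis ennreal_cases infinity_ennreal_def less_irrefl)
    have ab: "LT (\<lambda>x. \<nu> x + \<eta> x) s = ennreal (a + b)" using a b by (simp add: LT_add)
    have 1: "LT (CP (\<lambda>x. \<nu> x + \<eta> x) \<tau> step) s = ennreal (exp (\<tau> * (a + b - (m + n)))) * LT step s"
      using LT_CP[OF _ _ ab _ \<open>\<tau> \<ge> 0\<close>, of step] a b m n by (simp add: sum flip: ennreal_plus)
    have "LT (CP \<nu> \<tau> (CP \<eta> \<tau> step)) s
        = ennreal (exp (\<tau> * (a - m))) * (ennreal (exp (\<tau> * (b - n))) * LT step s)"
      using LT_CP[OF _ _ a \<open>\<tau> \<ge> 0\<close>, of "CP \<eta> \<tau> step"] LT_CP[OF _ _ b \<open>\<tau> \<ge> 0\<close>, of step] m n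
      by simp
    also have "\<dots> = ennreal (exp (\<tau> * (a + b - (m + n)))) * LT step s"
    proof -
      have "\<tau> * (a + b - (m + n)) = \<tau> * (a - m) + \<tau> * (b - n)" by (simp add: algebra_simps)
      then show ?thesis by (simp only: ennreal_mult_mult exp_ge_zero exp_add)
    qed
    finally show ?thesis using 1 LT_step[OF that] by (simp add: ennreal_mult_less_top)
  qed
  have z: "CP \<eta> \<tau> step t = 0" if "t < 0" for t
    using \<eta>0 that by (intro CP_eq_0) auto
  have "AE t in lborel. CP (\<lambda>x. \<nu> x + \<eta> x) \<tau> step t = CP \<nu> \<tau> (CP \<eta> \<tau> step) t"
    using \<nu>0 \<eta>0 z by (intro LT_unique CP_eq_0 *[THEN conjunct1] *[THEN conjunct2]) auto
  then show ?thesis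
  proof eventually_elim
    case (elim t)
    also have "CP \<nu> \<tau> (CP \<eta> \<tau> step) t \<le> CP \<nu> \<tau> step t"
      using CP_step_le[of \<eta>] \<eta>0 fin \<open>\<tau> \<ge> 0\<close> by (intro CP_mono) auto
    finally show ?case .
  qed
qed

lemma ennreal_mult_INF:
  assumes "r > 0"
  shows "ennreal r * (INF n. f n) = (INF n. ennreal r * f n)"
proof (rule antisym)
  show "ennreal r * (INF n. f n) \<le> (INF n. ennreal r * f n)"
    by (intro INF_greatest mult_left_mono INF_lower) auto
  have "ennreal (1 / r) * (INF n. ennreal r * f n) \<le> (INF n. f n)"
  proof (rule INF_greatest)
    fix n
    have "ennreal (1 / r) * (INF n. ennreal r * f n) \<le> ennreal (1 / r) * (ennreal r * f n)"
      by (intro mult_left_mono INF_lower) auto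
    also have "\<dots> = f n" using assms by (simp add: ennreal_mult_mult)
    finally show "ennreal (1 / r) * (INF n. ennreal r * f n) \<le> f n" .
  qed
  then have "ennreal r * (ennreal (1 / r) * (INF n. ennreal r * f n)) \<le> ennreal r * (INF n. f n)"
    by (intro mult_left_mono) auto
  then show "(INF n. ennreal r * f n) \<le> ennreal r * (INF n. f n)"
    using assms by (simp add: ennreal_mult_mult)
qed

section \<open>The law of the subordinator\<close>

text \<open>
  A density \<open>N\<close> of jumps, possibly of infinite mass at the origin, whose subordinator has the
  Laplace exponent \<open>g\<close>.
\<close>

locale levy_density =
  fixes N :: "real \<Rightarrow> ennreal" and g :: "real \<Rightarrow> real"
  assumes N_measurable [measurable]: "N \<in> borel_measurable borel"
    and N_support: "\<And>x. x \<le> 0 \<Longrightarrow> N x = 0"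
    and N_tail: "\<And>\<epsilon>. \<epsilon> > 0 \<Longrightarrow> (\<integral>\<^sup>+x. N x * indicator {\<epsilon><..} x \<partial>lborel) < \<infinity>"
    and N_symbol: "\<And>s. s > 0 \<Longrightarrow> (\<integral>\<^sup>+x. ennreal (1 - exp (- (s * x))) * N x \<partial>lborel) = ennreal (g s)"
    and g_nonneg: "\<And>s. s > 0 \<Longrightarrow> g s \<ge> 0"
begin

definition trunc :: "nat \<Rightarrow> real \<Rightarrow> ennreal" where
  "trunc n x = N x * indicator {1 / real (Suc n)<..} x"

text \<open>
  The distribution function of the subordinator at time \<open>\<tau>\<close>, obtained by admitting smaller and
  smaller jumps. Every additional jump lowers the distribution function, so that the limit exists
  as an infimum and Laplace transforms pass to the limit by monotone convergence.
\<close>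

definition subordinator_cdf :: "real \<Rightarrow> real \<Rightarrow> ennreal" where
  "subordinator_cdf \<tau> t = (INF n. CP (trunc n) \<tau> step t)"

lemma trunc_measurable [measurable]: "trunc n \<in> borel_measurable borel"
  unfolding trunc_def by measurable

lemma trunc_support: "x \<le> 0 \<Longrightarrow> trunc n x = 0"
  by (simp add: trunc_def N_support)

lemma trunc_finite: "(\<integral>\<^sup>+x. trunc n x \<partial>lborel) < \<infinity>"
  unfolding trunc_def by (rule N_tail) simp

lemma subordinator_cdf_measurable2 [measurable]:
  "(\<lambda>(\<tau>, t). subordinator_cdf \<tau> t) \<in> borel_measurable (borel \<Otimes>\<^sub>M borel)"
proof -
  have "(\<lambda>p. INF n. (\<lambda>(\<tau>, t). CP (trunc n) \<tau> step t) p) \<in> borel_measurable (borel \<Otimes>\<^sub>M borel)"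
    by measurable
  then show ?thesis unfolding subordinator_cdf_def by (simp add: case_prod_unfold)
qed

lemma subordinator_cdf_eq_0: "t < 0 \<Longrightarrow> subordinator_cdf \<tau> t = 0"
  unfolding subordinator_cdf_def using CP_eq_0[OF trunc_support, where f = step] by simp

lemma mono_subordinator_cdf: "mono (subordinator_cdf \<tau>)"
proof (rule monoI)
  have "mono step" by (auto simp: mono_def indicator_def)
  then show "subordinator_cdf \<tau> x \<le> subordinator_cdf \<tau> y" if "x \<le> y" for x y
    unfolding subordinator_cdf_def by (intro INF_mono' monoD[OF mono_CP] that)
qed

lemma trunc_Suc_antimono:
  assumes "\<tau> \<ge> 0"
  shows "AE t in lborel. CP (trunc (Suc n)) \<tau> step t \<le> CP (trunc n) \<tau> step t"
proof -
  define \<eta> where "\<eta> x = N x * indicator {1 / real (Suc (Suc n))<..1 / real (Suc n)} x" for x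
  have m: "\<eta> \<in> borel_measurable borel" unfolding \<eta>_def by measurable
  have le: "1 / real (Suc (Suc n)) \<le> 1 / real (Suc n)" by (intro divide_left_mono) auto
  have sum: "trunc (Suc n) = (\<lambda>x. trunc n x + \<eta> x)"
    using le by (auto simp: fun_eq_iff trunc_def \<eta>_def indicator_def simp del: of_nat_Suc)
  have "(\<integral>\<^sup>+x. \<eta> x \<partial>lborel) \<le> (\<integral>\<^sup>+x. trunc (Suc n) x \<partial>lborel)"
    unfolding sum by (intro nn_integral_mono) auto
  then have "(\<integral>\<^sup>+x. \<eta> x \<partial>lborel) < \<infinity>" using trunc_finite by (rule le_less_trans)
  then show ?thesis
    unfolding sum using m trunc_support trunc_finite N_support assms
    by (intro CP_step_antimono) (auto simp: \<eta>_def)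
qed

lemma LT_subordinator_cdf:
  assumes "\<tau> \<ge> 0" "s > 0"
  shows "LT (subordinator_cdf \<tau>) s = ennreal (exp (- (\<tau> * g s)) / s)"
proof -
  define G where "G n = enn2real (\<integral>\<^sup>+x. ennreal (1 - exp (- (s * x))) * trunc n x \<partial>lborel)" for n
  have le: "(\<integral>\<^sup>+x. ennreal (1 - exp (- (s * x))) * trunc n x \<partial>lborel) \<le> ennreal (g s)" for n
    unfolding N_symbol[OF assms(2), symmetric] trunc_def
    by (intro nn_integral_mono mult_left_mono) (auto simp: indicator_def)
  then have G: "(\<integral>\<^sup>+x. ennreal (1 - exp (- (s * x))) * trunc n x \<partial>lborel) = ennreal (G n)" for n
    unfolding G_def using le_less_trans[OF le[of n] ennreal_less_top] by simp
  have G0: "G n \<ge> 0" for n unfolding G_def by simp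
  have "(\<lambda>n. \<integral>\<^sup>+x. ennreal (1 - exp (- (s * x))) * trunc n x \<partial>lborel)
      \<longlonglongrightarrow> (\<integral>\<^sup>+x. ennreal (1 - exp (- (s * x))) * N x \<partial>lborel)"
  proof (rule nn_integral_LIMSEQ)
    show "incseq (\<lambda>n x. ennreal (1 - exp (- (s * x))) * trunc n x)"
    proof (rule incseq_SucI, rule le_funI, rule mult_left_mono)
      fix n x
      have "1 / real (Suc (Suc n)) \<le> 1 / real (Suc n)" by (intro divide_left_mono) auto
      then show "trunc n x \<le> trunc (Suc n) x"
        by (auto simp: trunc_def indicator_def simp del: of_nat_Suc)
    qed simp
    fix x
    show "(\<lambda>n. ennreal (1 - exp (- (s * x))) * trunc n x) \<longlonglongrightarrow> ennreal (1 - exp (- (s * x))) * N x"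
    proof (cases "x > 0")
      case True
      then have "\<forall>\<^sub>F n in sequentially. 1 / real (Suc n) < x"
        using order_tendstoD(2)[OF LIMSEQ_inverse_real_of_nat] by (simp add: inverse_eq_divide)
      then have "\<forall>\<^sub>F n in sequentially. ennreal (1 - exp (- (s * x))) * trunc n x
          = ennreal (1 - exp (- (s * x))) * N x"
        by eventually_elim (simp add: trunc_def)
      then show ?thesis by (rule tendsto_eventually)
    qed (simp add: N_support trunc_support)
  qed measurable
  then have Glim: "G \<longlonglongrightarrow> g s"
    unfolding G N_symbol[OF assms(2)] using G0 g_nonneg[OF assms(2)] by simp
  have CPn: "LT (CP (trunc n) \<tau> step) s = ennreal (exp (- (\<tau> * G n)) / s)" for n
  proof -
    have fin: "LT (trunc n) s < \<infinity>"
      using LT_le_nn_integral[of "trunc n" s] trunc_support trunc_finite[of n] assms(2)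
      by (auto intro: le_less_trans)
    then obtain a where a: "LT (trunc n) s = ennreal a" "a \<ge> 0"
      by (metis ennreal_cases infinity_ennreal_def less_irrefl)
    have "(\<integral>\<^sup>+x. trunc n x \<partial>lborel)
       = (\<integral>\<^sup>+x. ennreal (exp (- (s * x))) * trunc n x + ennreal (1 - exp (- (s * x))) * trunc n x \<partial>lborel)"
    proof (intro nn_integral_cong)
      fix x
      show "trunc n x = ennreal (exp (- (s * x))) * trunc n x + ennreal (1 - exp (- (s * x))) * trunc n x"
      proof (cases "x \<le> 0")
        case False
        then have "ennreal (exp (- (s * x))) + ennreal (1 - exp (- (s * x))) = 1"
          using assms(2) by (subst ennreal_plus[symmetric]) auto
        then show ?thesis by (metis distrib_right mult_1)
      qed (simp add: trunc_support)
    qed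
    also have "\<dots> = LT (trunc n) s + ennreal (G n)"
      unfolding LT_def G[symmetric] by (rule nn_integral_add) measurable
    also have "\<dots> = ennreal (a + G n)" using a G0[of n] by simp
    finally have "enn2real (\<integral>\<^sup>+x. trunc n x \<partial>lborel) = a + G n"
      using a G0[of n] by (simp flip: ennreal_plus)
    then have "LT (CP (trunc n) \<tau> step) s = ennreal (exp (\<tau> * (a - (a + G n)))) * LT step s"
      using LT_CP[OF _ _ a assms(1), of step] by simp
    then show ?thesis using LT_step[OF assms(2)] assms(2) by (simp add: ennreal_mult'[symmetric])
  qed
  have "LT (subordinator_cdf \<tau>) s = (\<integral>\<^sup>+t. (INF n. ennreal (exp (- (s * t))) * CP (trunc n) \<tau> step t) \<partial>lborel)"
    unfolding LT_def subordinator_cdf_def by (intro nn_integral_cong ennreal_mult_INF) auto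
  also have "\<dots> = (INF n. LT (CP (trunc n) \<tau> step) s)"
    unfolding LT_def
  proof (rule nn_integral_monotone_convergence_INF_AE')
    show "AE t in lborel. ennreal (exp (- (s * t))) * CP (trunc (Suc n)) \<tau> step t
      \<le> ennreal (exp (- (s * t))) * CP (trunc n) \<tau> step t" for n
      using trunc_Suc_antimono[OF assms(1), of n] by eventually_elim (auto intro: mult_left_mono)
    show "(\<integral>\<^sup>+t. ennreal (exp (- (s * t))) * CP (trunc 0) \<tau> step t \<partial>lborel) < \<infinity>"
      using CPn[of 0] unfolding LT_def by simp
  qed measurable
  also have "\<dots> = ennreal (exp (- (\<tau> * g s)) / s)"
  proof (rule LIMSEQ_unique)
    show "(\<lambda>n. LT (CP (trunc n) \<tau> step) s) \<longlonglongrightarrow> (INF n. LT (CP (trunc n) \<tau> step) s)"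
    proof (rule LIMSEQ_INF, rule decseq_SucI)
      fix n
      show "LT (CP (trunc (Suc n)) \<tau> step) s \<le> LT (CP (trunc n) \<tau> step) s"
        unfolding LT_def using trunc_Suc_antimono[OF assms(1), of n]
        by (intro nn_integral_mono_AE) (auto elim!: eventually_mono intro: mult_left_mono)
    qed
    show "(\<lambda>n. LT (CP (trunc n) \<tau> step) s) \<longlonglongrightarrow> ennreal (exp (- (\<tau> * g s)) / s)"
      unfolding CPn using assms(2) by (intro tendsto_intros Glim) auto
  qed
  finally show ?thesis .
qed

end

section \<open>Convolutions of continuous functions\<close>

text \<open>
  Functions that are continuous on the open half-line and locally integrable up to the origin.
  An almost everywhere equality between two of them is an equality, and they are closed under
  convolution; this turns identities of Laplace transforms into pointwise ones.
\<close>

definition half_line_continuous :: "(real \<Rightarrow> ennreal) \<Rightarrow> bool" where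
  "half_line_continuous f \<longleftrightarrow> f \<in> borel_measurable borel \<and> (\<forall>t\<le>0. f t = 0) \<and>
     continuous_on {0<..} f \<and> (\<forall>t. f t < \<infinity>) \<and> LT f 1 < \<infinity>"

lemma half_line_continuousD:
  assumes "half_line_continuous f"
  shows "f \<in> borel_measurable borel" "\<And>t. t \<le> 0 \<Longrightarrow> f t = 0" "continuous_on {0<..} f"
    "\<And>t. f t < \<infinity>" "LT f 1 < \<infinity>"
  using assms unfolding half_line_continuous_def by auto

lemma half_line_locally_integrable:
  assumes "half_line_continuous f"
  shows "(\<integral>\<^sup>+t. f t * indicator {..T} t \<partial>lborel) < \<infinity>"
proof -
  note [measurable] = half_line_continuousD(1)[OF assms]
  have "(\<integral>\<^sup>+t. f t * indicator {..T} t \<partial>lborel)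
      \<le> (\<integral>\<^sup>+t. ennreal (exp T) * (ennreal (exp (- (1 * t))) * f t) \<partial>lborel)"
  proof (rule nn_integral_mono)
    fix t
    show "f t * indicator {..T} t \<le> ennreal (exp T) * (ennreal (exp (- (1 * t))) * f t)"
    proof (cases "t \<le> T")
      case True
      then have "1 * f t \<le> ennreal (exp T * exp (- t)) * f t"
        by (intro mult_right_mono) (auto simp: exp_add[symmetric] simp del: ennreal_1 simp flip: ennreal_1)
      then show ?thesis using True by (simp add: ennreal_mult_mult)
    qed simp
  qed
  also have "\<dots> = ennreal (exp T) * LT f 1"
    unfolding LT_def by (rule nn_integral_cmult) measurable
  also have "\<dots> < \<infinity>" using half_line_continuousD(5)[OF assms] by (simp add: ennreal_mult_less_top)
  finally show ?thesis .
qed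

lemma half_line_bounded:
  assumes "half_line_continuous f" "0 < a" "a \<le> b"
  obtains B where "B < \<infinity>" "\<And>t. a \<le> t \<Longrightarrow> t \<le> b \<Longrightarrow> f t \<le> B"
proof -
  have "continuous_on {a..b} f"
    using half_line_continuousD(3)[OF assms(1)] by (rule continuous_on_subset) (use assms(2) in auto)
  then obtain x where "x \<in> {a..b}" "\<And>y. y \<in> {a..b} \<Longrightarrow> f y \<le> f x"
    using continuous_attains_sup[OF compact_Icc, of a b f] assms(3) by auto
  then show ?thesis using that[of "f x"] half_line_continuousD(4)[OF assms(1)] by auto
qed

text \<open>
  The part of a convolution in which the argument of the second factor exceeds \<open>t / 2\<close>. A
  convolution is the sum of two such parts, so that only one factor at a time can be singular.
\<close>

definition half_conv :: "(real \<Rightarrow> ennreal) \<Rightarrow> (real \<Rightarrow> ennreal) \<Rightarrow> real \<Rightarrow> ennreal" where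
  "half_conv f g t = (\<integral>\<^sup>+x. f x * g (t - x) * indicator {..<t / 2} x \<partial>lborel)"

lemma conv_eq_half_conv:
  assumes [measurable]: "f \<in> borel_measurable borel" "g \<in> borel_measurable borel"
  shows "conv f g t = half_conv f g t + half_conv g f t"
proof -
  have "half_conv g f t = (\<integral>\<^sup>+x. g (t - x) * f (t - (t - x)) * indicator {..<t / 2} (t - x) \<partial>lborel)"
    unfolding half_conv_def by (rule nn_integral_reflect[symmetric]) measurable
  also have "\<dots> = (\<integral>\<^sup>+x. f x * g (t - x) * indicator {t / 2<..} x \<partial>lborel)"
    by (intro nn_integral_cong) (auto simp: indicator_def mult.commute)
  finally have "half_conv f g t + half_conv g f t
      = (\<integral>\<^sup>+x. f x * g (t - x) * indicator {..<t / 2} x + f x * g (t - x) * indicator {t / 2<..} x \<partial>lborel)"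
    unfolding half_conv_def by (subst nn_integral_add) auto
  also have "\<dots> = conv f g t"
    unfolding conv_def using AE_lborel_singleton[of "t / 2"]
    by (intro nn_integral_cong_AE) (auto elim!: eventually_mono simp: indicator_def)
  finally show ?thesis by simp
qed

lemma half_conv_continuous:
  assumes f: "half_line_continuous f" and g: "half_line_continuous g" and t0: "t0 > 0"
  shows "half_conv f g t0 < \<infinity>" "isCont (half_conv f g) t0"
proof -
  note [measurable] = half_line_continuousD(1)[OF f] half_line_continuousD(1)[OF g]
  define S where "S = {3 * t0 / 4 <..< 5 * t0 / 4}"
  obtain B where B: "B < \<infinity>" "\<And>t. 3 * t0 / 8 \<le> t \<Longrightarrow> t \<le> 5 * t0 / 4 \<Longrightarrow> g t \<le> B"
    using half_line_bounded[OF g, of "3 * t0 / 8" "5 * t0 / 4"] t0 by auto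
  have le: "f x * g (t - x) * indicator {..<t / 2} x \<le> B * (f x * indicator {..t0} x)"
    if "t \<in> S" for t x
  proof (cases "0 < x \<and> x < t / 2")
    case True
    then have "g (t - x) \<le> B" using that by (intro B(2)) (auto simp: S_def)
    moreover have "x \<le> t0" using True that t0 by (auto simp: S_def)
    ultimately show ?thesis using True by (simp add: mult.commute[of B] mult_left_mono)
  next
    case False
    then show ?thesis using half_line_continuousD(2)[OF f, of x] by (auto simp: indicator_def)
  qed
  have dom: "(\<integral>\<^sup>+x. B * (f x * indicator {..t0} x) \<partial>lborel) < \<infinity>"
    using half_line_locally_integrable[OF f, of t0] B(1)
    by (subst nn_integral_cmult) (auto simp: ennreal_mult_less_top)
  have t0S: "t0 \<in> S" using t0 by (auto simp: S_def)
  have "half_conv f g t0 \<le> (\<integral>\<^sup>+x. B * (f x * indicator {..t0} x) \<partial>lborel)"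
    unfolding half_conv_def by (intro nn_integral_mono le t0S)
  then show "half_conv f g t0 < \<infinity>" using dom by (rule le_less_trans)
  have "(half_conv f g \<longlongrightarrow> half_conv f g t0) (at t0 within S)"
    unfolding tendsto_at_iff_sequentially
  proof (intro allI impI)
    fix X :: "nat \<Rightarrow> real" assume XS: "\<forall>i. X i \<in> S - {t0}" and X: "X \<longlonglongrightarrow> t0"
    have "(\<lambda>i. \<integral>\<^sup>+x. f x * g (X i - x) * indicator {..<X i / 2} x \<partial>lborel)
        \<longlonglongrightarrow> (\<integral>\<^sup>+x. f x * g (t0 - x) * indicator {..<t0 / 2} x \<partial>lborel)"
    proof (rule nn_integral_dominated_convergence[where w = "\<lambda>x. B * (f x * indicator {..t0} x)"])
      show "AE x in lborel. f x * g (X i - x) * indicator {..<X i / 2} x \<le> B * (f x * indicator {..t0} x)"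
        for i using XS by (intro AE_I2 le) auto
      show "AE x in lborel. (\<lambda>i. f x * g (X i - x) * indicator {..<X i / 2} x)
          \<longlonglongrightarrow> f x * g (t0 - x) * indicator {..<t0 / 2} x"
        using AE_lborel_singleton[of "t0 / 2"]
      proof eventually_elim
        fix x assume ne: "x \<noteq> t0 / 2"
        have X2: "(\<lambda>i. X i / 2) \<longlonglongrightarrow> t0 / 2" using X by (intro tendsto_intros) auto
        show "(\<lambda>i. f x * g (X i - x) * indicator {..<X i / 2} x)
          \<longlonglongrightarrow> f x * g (t0 - x) * indicator {..<t0 / 2} x"
        proof (cases "x < t0 / 2")
          case True
          have ev: "\<forall>\<^sub>F i in sequentially. x < X i / 2" using X2 True by (rule order_tendstoD)
          have "isCont g (t0 - x)"
            using half_line_continuousD(3)[OF g] True t0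
            by (intro continuous_on_interior) (auto simp: interior_open)
          then have "(\<lambda>i. g (X i - x)) \<longlonglongrightarrow> g (t0 - x)"
            by (rule isCont_tendsto_compose) (intro tendsto_intros X)
          then have "(\<lambda>i. f x * g (X i - x)) \<longlonglongrightarrow> f x * g (t0 - x)"
            using half_line_continuousD(4)[OF f, of x] by (intro ennreal_tendsto_cmult) auto
          then have "(\<lambda>i. f x * g (X i - x) * indicator {..<X i / 2} x) \<longlonglongrightarrow> f x * g (t0 - x)"
            by (rule Lim_transform_eventually) (use ev in eventually_elim, simp)
          then show ?thesis using True by simp
        next
          case False
          then have "t0 / 2 < x" using ne by simp
          then have ev: "\<forall>\<^sub>F i in sequentially. X i / 2 < x" using X2 by (intro order_tendstoD)
          have "\<forall>\<^sub>F i in sequentially.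
              f x * g (X i - x) * indicator {..<X i / 2} x = f x * g (t0 - x) * indicator {..<t0 / 2} x"
            using ev by eventually_elim (use False in simp)
          then show ?thesis by (rule tendsto_eventually)
        qed
      qed
    qed (use dom in simp_all)
    then show "(half_conv f g \<circ> X) \<longlonglongrightarrow> half_conv f g t0"
      unfolding half_conv_def comp_def .
  qed
  then show "isCont (half_conv f g) t0"
    using at_within_open[OF t0S] unfolding isCont_def S_def by simp
qed

lemma half_line_continuous_conv:
  assumes f: "half_line_continuous f" and g: "half_line_continuous g"
  shows "half_line_continuous (conv f g)"
  unfolding half_line_continuous_def
proof (intro conjI allI impI)
  note [measurable] = half_line_continuousD(1)[OF f] half_line_continuousD(1)[OF g]
  note fg = half_conv_continuous[OF f g] half_conv_continuous[OF g f]
  have eq: "conv f g = (\<lambda>t. half_conv f g t + half_conv g f t)"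
    by (intro ext conv_eq_half_conv) measurable
  show "conv f g \<in> borel_measurable borel" by measurable
  show z: "conv f g t = 0" if "t \<le> 0" for t
    using half_line_continuousD(2)[OF f] half_line_continuousD(2)[OF g] that by (intro conv_eq_0) auto
  show "continuous_on {0<..} (conv f g)"
    unfolding eq using fg
    by (intro continuous_at_imp_continuous_on ballI continuous_add) auto
  show "conv f g t < \<infinity>" for t
  proof (cases "t \<le> 0")
    case False
    then show ?thesis unfolding eq using fg by (simp add: less_top)
  qed (simp add: z)
  show "LT (conv f g) 1 < \<infinity>"
    using half_line_continuousD(5)[OF f] half_line_continuousD(5)[OF g]
    by (simp add: LT_conv ennreal_mult_less_top)
qed

text \<open>A nonempty open set is not a null set.\<close>

lemma continuous_AE_eq_imp_eq:
  fixes f g :: "real \<Rightarrow> 'b::t2_space"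
  assumes f: "continuous_on {0<..} f" and g: "continuous_on {0<..} g"
    and eq: "AE t in lborel. t > 0 \<longrightarrow> f t = g t" and "t > 0"
  shows "f t = g t"
proof (rule ccontr)
  assume ne: "f t \<noteq> g t"
  define U where "U = {t \<in> {0<..}. f t \<noteq> g t}"
  have "open U"
  proof -
    have "open ((\<lambda>t. (f t, g t)) -` {(x, y) |x y. x \<noteq> y} \<inter> {0<..})"
      using continuous_on_open_vimage[of "{0<..}" "\<lambda>t. (f t, g t)"]
        continuous_on_Pair[OF f g] open_diagonal_complement by auto
    moreover have "(\<lambda>t. (f t, g t)) -` {(x, y) |x y. x \<noteq> y} \<inter> {0<..} = U"
      unfolding U_def by auto
    ultimately show ?thesis by simp
  qed
  have "AE t in lebesgue. t \<in> - U"
    using AE_completion[OF eq] by eventually_elim (auto simp: U_def)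
  then have "t \<in> - U" if "t \<in> UNIV"
    using mem_closed_if_AE_lebesgue[of "- U" t] \<open>open U\<close> by auto
  then show False using ne \<open>t > 0\<close> unfolding U_def by auto
qed

section \<open>Integrals of elementary functions\<close>

lemma nn_integral_exp_Icc:
  assumes "s > 0" "y \<ge> 0"
  shows "(\<integral>\<^sup>+x. ennreal (exp (- (s * x))) * indicator {0..y} x \<partial>lborel) = ennreal ((1 - exp (- (s * y))) / s)"
proof -
  have "(\<integral>\<^sup>+x. ennreal (exp (- (s * x))) * indicator {0..y} x \<partial>lborel)
      = ennreal (- exp (- (s * y)) / s - (- exp (- (s * 0)) / s))"
    by (rule nn_integral_FTC_Icc) (use assms in \<open>auto intro!: derivative_eq_intros simp: field_simps\<close>)
  then show ?thesis by (simp add: diff_divide_distrib)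
qed

lemma nn_integral_mult_exp_Icc:
  assumes "s > 0" "y \<ge> 0"
  shows "(\<integral>\<^sup>+x. ennreal (x * exp (- (s * x))) * indicator {0..y} x \<partial>lborel)
    = ennreal ((1 - exp (- (s * y))) / s\<^sup>2 - y * exp (- (s * y)) / s)"
proof -
  define F where "F x = (1 - exp (- (s * x))) / s\<^sup>2 - x * exp (- (s * x)) / s" for x
  have "(\<integral>\<^sup>+x. ennreal (x * exp (- (s * x))) * indicator {0..y} x \<partial>lborel) = ennreal (F y - F 0)"
  proof (rule nn_integral_FTC_Icc)
    fix x
    have "((\<lambda>x. (1 - exp (- (s * x))) * b\<^sup>2 - x * exp (- (s * x)) * b) has_real_derivative
        s * b * b * exp (- (s * x)) - (exp (- (s * x)) - s * x * exp (- (s * x))) * b) (at x)" for b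
      by (auto intro!: derivative_eq_intros simp: power2_eq_square algebra_simps)
    from this[of "1 / s"] show "(F has_real_derivative x * exp (- (s * x))) (at x)"
      unfolding F_def using assms by (simp add: power_divide algebra_simps)
  qed (use assms in auto)
  then show ?thesis unfolding F_def by simp
qed

lemma LT_step_Ioi:
  assumes "s > 0"
  shows "LT (indicator {0<..}) s = ennreal (1 / s)"
proof -
  have "LT (indicator {0<..}) s = LT step s"
    using AE_lborel_singleton[of "0 :: real"]
    by (intro LT_cong_AE) (auto elim!: eventually_mono simp: indicator_def)
  then show ?thesis using LT_step[OF assms] by simp
qed

text \<open>The function \<open>t\<close> on the half-line is the convolution of the unit step with itself.\<close>

lemma LT_ident:
  assumes "s > 0"
  shows "LT (\<lambda>t. ennreal t * indicator {0<..} t) s = ennreal (1 / s\<^sup>2)"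
proof -
  have "ennreal t * indicator {0<..} t = conv step step t" for t :: real
  proof -
    have "conv step step t = (\<integral>\<^sup>+x. indicator {0..t} x \<partial>lborel)"
      unfolding conv_def by (intro nn_integral_cong) (auto simp: indicator_def)
    then show ?thesis by (cases "t > 0") (auto simp: emeasure_lborel_Icc_eq)
  qed
  then have "LT (\<lambda>t. ennreal t * indicator {0<..} t) s = LT step s * LT step s"
    by (simp add: LT_conv)
  then show ?thesis
    using LT_step[OF assms] assms by (simp add: power2_eq_square flip: ennreal_mult)
qed

lemma LT_measurable [measurable]:
  assumes [measurable]: "f \<in> borel_measurable borel"
  shows "LT f \<in> borel_measurable borel"
  unfolding LT_def by measurable

lemma measurable_indicator_intervals [measurable (raw)]:
  fixes f g h :: "'a \<Rightarrow> real"
  assumes [measurable]: "f \<in> borel_measurable M" "g \<in> borel_measurable M" "h \<in> borel_measurable M"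
  shows "(\<lambda>x. indicator {f x..} (g x) :: ennreal) \<in> borel_measurable M"
    and "(\<lambda>x. indicator {f x..h x} (g x) :: ennreal) \<in> borel_measurable M"
proof -
  have "(\<lambda>x. if f x \<le> g x then 1 else 0 :: ennreal) \<in> borel_measurable M"
    "(\<lambda>x. if f x \<le> g x \<and> g x \<le> h x then 1 else 0 :: ennreal) \<in> borel_measurable M"
    by measurable
  then show "(\<lambda>x. indicator {f x..} (g x) :: ennreal) \<in> borel_measurable M"
      "(\<lambda>x. indicator {f x..h x} (g x) :: ennreal) \<in> borel_measurable M"
    by (simp_all add: indicator_def of_bool_def)
qed

lemma measurable_Ioi:
  assumes "continuous_on {0<..} (f :: real \<Rightarrow> real)"
  shows "(\<lambda>x. ennreal (f x) * indicator {0<..} x) \<in> borel_measurable borel"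
proof -
  have "(\<lambda>x. indicator {0<..} x *\<^sub>R f x) \<in> borel_measurable borel"
    by (rule borel_measurable_continuous_on_indicator) (use assms in auto)
  then have "(\<lambda>x. ennreal (indicator {0<..} x *\<^sub>R f x)) \<in> borel_measurable borel"
    by measurable
  also have "(\<lambda>x. ennreal (indicator {0<..} x *\<^sub>R f x)) = (\<lambda>x. ennreal (f x) * indicator {0<..} x)"
    by (auto simp: indicator_def)
  finally show ?thesis .
qed

section \<open>Convex kernels\<close>

text \<open>
  The properties of a completely monotone kernel \<open>k\<close> that the construction uses: \<open>k\<close> is
  nonincreasing and convex, and its tails can be recovered from its derivatives. The symbol is
  \<open>g(s) = s K(s)\<close>, where \<open>K\<close> is the Laplace transform of \<open>k\<close>.
\<close>

locale relaxation_kernel =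
  fixes k k' k'' g :: "real \<Rightarrow> real"
  assumes k_deriv: "\<And>x. x > 0 \<Longrightarrow> (k has_real_derivative k' x) (at x)"
    and k'_deriv: "\<And>x. x > 0 \<Longrightarrow> (k' has_real_derivative k'' x) (at x)"
    and k''_cont: "continuous_on {0<..} k''"
    and k_nonneg: "\<And>x. x > 0 \<Longrightarrow> k x \<ge> 0"
    and k'_nonpos: "\<And>x. x > 0 \<Longrightarrow> k' x \<le> 0"
    and k''_nonneg: "\<And>x. x > 0 \<Longrightarrow> k'' x \<ge> 0"
    and k_lim: "(k \<longlongrightarrow> 0) at_top"
    and LT_k: "\<And>s. s > 0 \<Longrightarrow> LT (\<lambda>x. ennreal (k x) * indicator {0<..} x) s = ennreal (g s / s)"
    and g_pos: "\<And>s. s > 0 \<Longrightarrow> g s > 0"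
    and g_top: "filterlim g at_top at_top"
    and g_zero: "(g \<longlongrightarrow> 0) (at_right 0)"
begin

text \<open>
  Integration by parts turns \<open>g(s) = s K(s)\<close> into the Laplace exponent of the jump density
  \<open>- k'\<close>; consequently the derivative of \<open>g\<close> is the Laplace transform of \<open>- x k'(x)\<close>.
\<close>

definition kernel :: "real \<Rightarrow> ennreal" where
  "kernel x = ennreal (k x) * indicator {0<..} x"

definition levy :: "real \<Rightarrow> ennreal" where
  "levy x = ennreal (- k' x) * indicator {0<..} x"

definition levy_slope :: "real \<Rightarrow> ennreal" where
  "levy_slope x = ennreal (k'' x) * indicator {0<..} x"

definition levy_ident :: "real \<Rightarrow> ennreal" where
  "levy_ident x = ennreal x * levy x"

lemma k_cont: "continuous_on {0<..} k"
  by (auto intro!: continuous_at_imp_continuous_on DERIV_isCont[OF k_deriv])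

lemma k'_cont: "continuous_on {0<..} k'"
  by (auto intro!: continuous_at_imp_continuous_on DERIV_isCont[OF k'_deriv])

lemma kernel_measurable [measurable]: "kernel \<in> borel_measurable borel"
  unfolding kernel_def by (rule measurable_Ioi[OF k_cont])

lemma levy_measurable [measurable]: "levy \<in> borel_measurable borel"
  unfolding levy_def by (intro measurable_Ioi continuous_intros k'_cont)

lemma levy_slope_measurable [measurable]: "levy_slope \<in> borel_measurable borel"
  unfolding levy_slope_def by (rule measurable_Ioi[OF k''_cont])

lemma levy_ident_measurable [measurable]: "levy_ident \<in> borel_measurable borel"
  unfolding levy_ident_def by measurable

lemma DERIV_nonneg_FTC:
  assumes "\<And>x. x > 0 \<Longrightarrow> (F has_real_derivative f x) (at x)" "continuous_on {0<..} f"
    "\<And>x. x > 0 \<Longrightarrow> f x \<ge> 0" "(F \<longlongrightarrow> 0) at_top" "a > 0"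
  shows "(\<integral>\<^sup>+x. ennreal (f x) * indicator {0<..} x * indicator {a..} x \<partial>lborel) = ennreal (- F a)"
proof -
  have m: "(\<lambda>x. indicator {0<..} x *\<^sub>R f x) \<in> borel_measurable borel"
    by (rule borel_measurable_continuous_on_indicator) (use assms in auto)
  have "(\<integral>\<^sup>+x. ennreal (indicator {0<..} x *\<^sub>R f x) * indicator {a..} x \<partial>lborel) = ennreal (0 - F a)"
    by (rule nn_integral_FTC_atLeast[OF m]) (use assms in auto)
  moreover have "ennreal (indicator {0<..} x *\<^sub>R f x) * indicator {a..} x
      = ennreal (f x) * indicator {0<..} x * indicator {a..} x" for x
    by (simp add: indicator_def)
  ultimately show ?thesis by simp
qed

lemma nn_integral_levy_tail:
  assumes "a > 0"
  shows "(\<integral>\<^sup>+x. levy x * indicator {a..} x \<partial>lborel) = ennreal (k a)"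
proof -
  have "((\<lambda>x. - k x) \<longlongrightarrow> 0) at_top" using tendsto_minus[OF k_lim] by simp
  then show ?thesis unfolding levy_def using assms k'_nonpos
    by (subst DERIV_nonneg_FTC[where F = "\<lambda>x. - k x"])
      (auto intro!: derivative_eq_intros continuous_intros k_deriv k'_cont)
qed

text \<open>By convexity, \<open>- k' (x + 1)\<close> is at most the decrease of \<open>k\<close> over \<open>[x, x + 1]\<close>.\<close>

lemma k'_lim: "(k' \<longlongrightarrow> 0) at_top"
proof -
  have "((\<lambda>x. - k' (x + 1)) \<longlongrightarrow> 0) at_top"
  proof (rule tendsto_sandwich[OF _ _ tendsto_const k_lim])
    show "\<forall>\<^sub>F x in at_top. 0 \<le> - k' (x + 1)"
      using eventually_gt_at_top[of "0::real"] by eventually_elim (simp add: k'_nonpos)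
    show "\<forall>\<^sub>F x in at_top. - k' (x + 1) \<le> k x"
      using eventually_gt_at_top[of "0::real"]
    proof eventually_elim
      fix x :: real assume x: "0 < x"
      obtain z where z: "x < z" "z < x + 1" "k (x + 1) - k x = (x + 1 - x) * k' z"
        using MVT2[of x "x + 1" k k'] k_deriv x by auto
      have "k' z \<le> k' (x + 1)"
      proof (rule DERIV_nonneg_imp_nondecreasing[where f = k'])
        fix y assume "z \<le> y"
        then show "\<exists>d. (k' has_real_derivative d) (at y) \<and> 0 \<le> d"
          using z x k'_deriv[of y] k''_nonneg[of y] by (intro exI[of _ "k'' y"]) auto
      qed (use z in simp)
      moreover have "k (x + 1) \<ge> 0" using k_nonneg x by simp
      ultimately show "- k' (x + 1) \<le> k x" using z by simp
    qed
  qed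
  have "filterlim (\<lambda>x::real. x - 1) at_top at_top"
    using filterlim_tendsto_add_at_top[OF tendsto_const[of "- 1::real"] filterlim_ident] by simp
  with \<open>((\<lambda>x. - k' (x + 1)) \<longlongrightarrow> 0) at_top\<close> have "((\<lambda>x. - k' (x - 1 + 1)) \<longlongrightarrow> 0) at_top"
    by (rule filterlim_compose)
  then show ?thesis using tendsto_minus by fastforce
qed

lemma nn_integral_levy_slope:
  assumes "a > 0"
  shows "(\<integral>\<^sup>+x. levy_slope x * indicator {a..} x \<partial>lborel) = levy a"
  unfolding levy_slope_def using assms k''_nonneg
  by (subst DERIV_nonneg_FTC[OF k'_deriv k''_cont _ k'_lim]) (auto simp: levy_def)

text \<open>
  The kernel is the tail of its jump density; exchanging the integrals is the integration by parts.
\<close>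

lemma levy_symbol:
  assumes s: "s > 0"
  shows "(\<integral>\<^sup>+x. ennreal (1 - exp (- (s * x))) * levy x \<partial>lborel) = ennreal (g s)"
proof -
  have "ennreal (g s / s) = LT kernel s"
    using LT_k[OF s] unfolding kernel_def by simp
  also have "\<dots> = LT (\<lambda>t. \<integral>\<^sup>+x. levy x * indicator {0<..} t * indicator {t..} x \<partial>lborel) s"
  proof (intro arg_cong[where f = "\<lambda>f. LT f s"] ext)
    fix t
    show "kernel t = (\<integral>\<^sup>+x. levy x * indicator {0<..} t * indicator {t..} x \<partial>lborel)"
      using nn_integral_levy_tail[of t] by (cases "t > 0") (auto simp: kernel_def)
  qed
  also have "\<dots> = (\<integral>\<^sup>+x. LT (\<lambda>t. levy x * indicator {0<..} t * indicator {t..} x) s \<partial>lborel)"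
    by (rule LT_nn_integral) measurable
  also have "\<dots> = (\<integral>\<^sup>+x. ennreal (1 / s) * (ennreal (1 - exp (- (s * x))) * levy x) \<partial>lborel)"
  proof (intro nn_integral_cong)
    fix x
    have "LT (\<lambda>t. levy x * indicator {0<..} t * indicator {t..} x) s
        = LT (\<lambda>t. levy x * indicator {0..x} t) s"
      using AE_lborel_singleton[of "0 :: real"]
      by (intro LT_cong_AE) (auto elim!: eventually_mono simp: indicator_def)
    also have "\<dots> = levy x * LT (indicator {0..x}) s" by (rule LT_cmult) measurable
    also have "\<dots> = ennreal (1 / s) * (ennreal (1 - exp (- (s * x))) * levy x)"
    proof (cases "x > 0")
      case True
      then have "LT (indicator {0..x}) s = ennreal (1 / s * (1 - exp (- (s * x))))"
        using nn_integral_exp_Icc[of s x] s unfolding LT_def by simp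
      then show ?thesis using s by (simp add: ennreal_mult_mult mult.commute[of "levy x"])
    qed (simp add: levy_def)
    finally show "LT (\<lambda>t. levy x * indicator {0<..} t * indicator {t..} x) s
        = ennreal (1 / s) * (ennreal (1 - exp (- (s * x))) * levy x)" .
  qed
  also have "\<dots> = ennreal (1 / s) * (\<integral>\<^sup>+x. ennreal (1 - exp (- (s * x))) * levy x \<partial>lborel)"
    by (rule nn_integral_cmult) measurable
  finally have "ennreal s * ennreal (g s / s)
      = ennreal s * (ennreal (1 / s) * (\<integral>\<^sup>+x. ennreal (1 - exp (- (s * x))) * levy x \<partial>lborel))"
    by simp
  then show ?thesis using s by (simp add: ennreal_mult_mult flip: ennreal_mult')
qed

sublocale levy_density levy g
proof
  show "levy x = 0" if "x \<le> 0" for x using that by (simp add: levy_def)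
  show "(\<integral>\<^sup>+x. levy x * indicator {\<epsilon><..} x \<partial>lborel) < \<infinity>" if "\<epsilon> > 0" for \<epsilon>
  proof -
    have "(\<integral>\<^sup>+x. levy x * indicator {\<epsilon><..} x \<partial>lborel) \<le> (\<integral>\<^sup>+x. levy x * indicator {\<epsilon>..} x \<partial>lborel)"
      by (intro nn_integral_mono mult_left_mono) (auto simp: indicator_def)
    then show ?thesis using nn_integral_levy_tail[OF that] by (simp add: le_less_trans)
  qed
qed (use levy_symbol g_pos in \<open>auto intro: less_imp_le\<close>)

lemma mult_exp_le:
  assumes "s > 0" "x \<ge> (0::real)"
  shows "x * exp (- (s * x)) \<le> (1 - exp (- (s * x))) / s"
proof -
  have "s * x + 1 \<le> exp (s * x)" using exp_ge_add_one_self[of "s * x"] by (simp add: add.commute)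
  then have "(s * x + 1) * exp (- (s * x)) \<le> exp (s * x) * exp (- (s * x))"
    by (intro mult_right_mono) auto
  then show ?thesis using assms by (simp add: exp_add[symmetric] field_simps)
qed

lemma LT_levy_ident_finite:
  assumes "s > 0"
  shows "LT levy_ident s < \<infinity>"
proof -
  have "LT levy_ident s \<le> (\<integral>\<^sup>+x. ennreal (1 / s) * (ennreal (1 - exp (- (s * x))) * levy x) \<partial>lborel)"
    unfolding LT_def
  proof (intro nn_integral_mono)
    fix x
    show "ennreal (exp (- (s * x))) * levy_ident x \<le> ennreal (1 / s) * (ennreal (1 - exp (- (s * x))) * levy x)"
    proof (cases "x > 0")
      case True
      then have "ennreal (x * exp (- (s * x))) * levy x \<le> ennreal (1 / s * (1 - exp (- (s * x)))) * levy x"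
        using mult_exp_le[OF assms, of x] by (intro mult_right_mono ennreal_leI) auto
      also have "\<dots> = ennreal (1 / s) * (ennreal (1 - exp (- (s * x))) * levy x)"
        using assms by (intro ennreal_mult_mult[symmetric]) simp
      finally show ?thesis
        using True unfolding levy_ident_def by (simp add: ennreal_mult_mult mult.commute[of x])
    qed (simp add: levy_ident_def levy_def)
  qed
  also have "\<dots> = ennreal (1 / s) * ennreal (g s)"
    unfolding levy_symbol[OF assms, symmetric] by (rule nn_integral_cmult) measurable
  also have "\<dots> < \<infinity>" by (simp add: ennreal_mult_less_top)
  finally show ?thesis .
qed

definition g' :: "real \<Rightarrow> real" where
  "g' s = enn2real (LT levy_ident s)"

lemma LT_levy_ident: "s > 0 \<Longrightarrow> LT levy_ident s = ennreal (g' s)"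
  using LT_levy_ident_finite[of s] by (simp add: g'_def)

lemma exp_diff_quotient_le:
  assumes "(a::real) > 0" "a \<le> r" "a \<le> s" "x \<ge> 0" "r \<noteq> s"
  shows "\<bar>(exp (- (s * x)) - exp (- (r * x))) / (r - s)\<bar> \<le> x * exp (- (a * x))"
proof -
  have main: "\<bar>exp (- (p * x)) - exp (- (q * x))\<bar> \<le> (q - p) * (x * exp (- (a * x)))"
    if "a \<le> p" "p < q" for p q
  proof -
    have "exp (- (q * x)) = exp (- (p * x)) * exp (- ((q - p) * x))"
    proof -
      have "- (q * x) = - (p * x) + - ((q - p) * x)" by (simp add: algebra_simps)
      then show ?thesis by (simp only: exp_add[symmetric])
    qed
    moreover have "1 - (q - p) * x \<le> exp (- ((q - p) * x))"
      using exp_ge_add_one_self[of "- ((q - p) * x)"] by simp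
    ultimately have "exp (- (p * x)) - exp (- (q * x)) \<le> exp (- (p * x)) * ((q - p) * x)"
      using mult_left_mono[of "1 - (q - p) * x" "exp (- ((q - p) * x))" "exp (- (p * x))"]
      by (simp add: algebra_simps)
    also have "\<dots> \<le> exp (- (a * x)) * ((q - p) * x)"
      using that assms by (intro mult_right_mono) (auto intro: mult_right_mono)
    finally have "exp (- (p * x)) - exp (- (q * x)) \<le> (q - p) * (x * exp (- (a * x)))"
      by (simp add: ac_simps)
    moreover have "exp (- (q * x)) \<le> exp (- (p * x))"
      using that assms by (auto intro: mult_right_mono)
    ultimately show ?thesis by simp
  qed
  show ?thesis
  proof (cases "s < r")
    case True
    then show ?thesis using main[of s r] assms by (simp add: abs_divide pos_divide_le_eq mult.commute)
  next
    case False
    then have "r < s" using assms by simp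
    then show ?thesis using main[of r s] assms
      by (simp add: abs_divide pos_divide_le_eq mult.commute abs_minus_commute)
  qed
qed

lemma g_integral:
  assumes "s > 0"
  shows "integrable lborel (\<lambda>x. (1 - exp (- (s * x))) * enn2real (levy x))"
    and "(\<integral>x. (1 - exp (- (s * x))) * enn2real (levy x) \<partial>lborel) = g s"
proof -
  have nn: "0 \<le> (1 - exp (- (s * x))) * enn2real (levy x)" for x
    using assms by (cases "x > 0") (auto simp: levy_def)
  have eq: "ennreal ((1 - exp (- (s * x))) * enn2real (levy x)) = ennreal (1 - exp (- (s * x))) * levy x" for x
    using assms k'_nonpos[of x]
    by (cases "x > 0") (auto simp: levy_def ennreal_mult'[symmetric] mult.commute)
  have int: "(\<integral>\<^sup>+x. ennreal ((1 - exp (- (s * x))) * enn2real (levy x)) \<partial>lborel) = ennreal (g s)"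
    unfolding eq by (rule levy_symbol[OF assms])
  show "integrable lborel (\<lambda>x. (1 - exp (- (s * x))) * enn2real (levy x))"
    by (rule integrableI_nn_integral_finite[OF _ _ int]) (use nn in auto)
  show "(\<integral>x. (1 - exp (- (s * x))) * enn2real (levy x) \<partial>lborel) = g s"
    using nn int g_nonneg[OF assms] by (subst integral_eq_nn_integral) auto
qed

lemma levy_ident_integral:
  assumes "s > 0"
  shows "integrable lborel (\<lambda>x. x * exp (- (s * x)) * enn2real (levy x))"
    and "(\<integral>x. x * exp (- (s * x)) * enn2real (levy x) \<partial>lborel) = g' s"
proof -
  have nn: "0 \<le> x * exp (- (s * x)) * enn2real (levy x)" for x
    by (cases "x > 0") (auto simp: levy_def)
  have eq: "ennreal (x * exp (- (s * x)) * enn2real (levy x)) = ennreal (exp (- (s * x))) * levy_ident x" for x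
  proof (cases "x > 0")
    case True
    then have "ennreal (exp (- (s * x))) * (ennreal x * ennreal (- k' x)) = ennreal (exp (- (s * x)) * (x * - k' x))"
      by (simp only: ennreal_mult' exp_ge_zero less_imp_le)
    also have "exp (- (s * x)) * (x * - k' x) = x * exp (- (s * x)) * - k' x" by simp
    finally show ?thesis using True k'_nonpos[of x] by (simp add: levy_ident_def levy_def)
  qed (simp add: levy_ident_def levy_def)
  have int: "(\<integral>\<^sup>+x. ennreal (x * exp (- (s * x)) * enn2real (levy x)) \<partial>lborel) = ennreal (g' s)"
    unfolding eq using LT_levy_ident[OF assms] unfolding LT_def .
  show "integrable lborel (\<lambda>x. x * exp (- (s * x)) * enn2real (levy x))"
    by (rule integrableI_nn_integral_finite[OF _ _ int]) (use nn in auto)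
  show "(\<integral>x. x * exp (- (s * x)) * enn2real (levy x) \<partial>lborel) = g' s"
    using nn int by (subst integral_eq_nn_integral) (auto simp: g'_def)
qed

section \<open>Densities of the subordinator\<close>

text \<open>Differentiation under the integral sign, by dominated convergence.\<close>

lemma g_deriv:
  assumes s: "s > 0"
  shows "(g has_real_derivative g' s) (at s)"
proof -
  \<comment> \<open>For \<open>r > a\<close> the difference quotients are dominated by \<open>x exp (- a x)\<close>.\<close>
  define a where "a = s / 2"
  have a: "a > 0" "a < s" using s by (auto simp: a_def)
  have "((\<lambda>r. (g r - g s) / (r - s)) \<longlongrightarrow> g' s) (at s within {a<..})"
    unfolding tendsto_at_iff_sequentially
  proof (intro allI impI)
    fix X :: "nat \<Rightarrow> real" assume XS: "\<forall>i. X i \<in> {a<..} - {s}" and X: "X \<longlonglongrightarrow> s"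
    define n where "n x = enn2real (levy x)" for x
    have [measurable]: "n \<in> borel_measurable borel" unfolding n_def by measurable
    have n0: "n x \<ge> 0" "x \<le> 0 \<Longrightarrow> n x = 0" for x unfolding n_def levy_def by auto
    have "(\<lambda>i. \<integral>x. (exp (- (s * x)) - exp (- (X i * x))) / (X i - s) * n x \<partial>lborel)
      \<longlonglongrightarrow> (\<integral>x. x * exp (- (s * x)) * n x \<partial>lborel)"
    proof (rule integral_dominated_convergence[where w = "\<lambda>x. x * exp (- (a * x)) * n x"])
      show "integrable lborel (\<lambda>x. x * exp (- (a * x)) * n x)"
        unfolding n_def by (rule levy_ident_integral(1)[OF a(1)])
      show "AE x in lborel. (\<lambda>i. (exp (- (s * x)) - exp (- (X i * x))) / (X i - s) * n x)
          \<longlonglongrightarrow> x * exp (- (s * x)) * n x"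
      proof (intro AE_I2 tendsto_intros)
        fix x
        have "((\<lambda>r. - exp (- (r * x))) has_real_derivative x * exp (- (s * x))) (at s)"
          by (auto intro!: derivative_eq_intros)
        then have "((\<lambda>r. (- exp (- (r * x)) - - exp (- (s * x))) / (r - s)) \<longlongrightarrow> x * exp (- (s * x))) (at s)"
          unfolding has_field_derivative_iff by simp
        moreover have "filterlim X (at s) sequentially"
          unfolding filterlim_at using X XS by (auto intro!: always_eventually)
        ultimately show "(\<lambda>i. (exp (- (s * x)) - exp (- (X i * x))) / (X i - s)) \<longlonglongrightarrow> x * exp (- (s * x))"
          by (auto dest: filterlim_compose)
      qed
      fix i
      have Xi: "a \<le> X i" "X i \<noteq> s" using XS by (auto intro: less_imp_le)
      show "AE x in lborel. norm ((exp (- (s * x)) - exp (- (X i * x))) / (X i - s) * n x)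
          \<le> x * exp (- (a * x)) * n x"
      proof (rule AE_I2)
        fix x
        show "norm ((exp (- (s * x)) - exp (- (X i * x))) / (X i - s) * n x) \<le> x * exp (- (a * x)) * n x"
        proof (cases "x \<le> 0")
          case False
          then show ?thesis
            using exp_diff_quotient_le[OF a(1) Xi(1) less_imp_le[OF a(2)] _ Xi(2), of x] n0(1)[of x]
            unfolding real_norm_def abs_mult by (intro mult_mono) auto
        qed (simp add: n0)
      qed
    qed measurable
    moreover have "(\<integral>x. (exp (- (s * x)) - exp (- (X i * x))) / (X i - s) * n x \<partial>lborel)
        = (g (X i) - g s) / (X i - s)" for i
    proof -
      have Xi: "X i > 0" using XS a(1) by (meson DiffE greaterThan_iff less_trans)
      have "(\<integral>x. (1 - exp (- (X i * x))) * n x - (1 - exp (- (s * x))) * n x \<partial>lborel) = g (X i) - g s"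
        using g_integral[OF Xi] g_integral[OF s] unfolding n_def[symmetric] by simp
      then have "(\<integral>x. ((1 - exp (- (X i * x))) * n x - (1 - exp (- (s * x))) * n x) / (X i - s) \<partial>lborel)
          = (g (X i) - g s) / (X i - s)" by simp
      moreover have "((1 - exp (- (X i * x))) * n x - (1 - exp (- (s * x))) * n x) / (X i - s)
          = (exp (- (s * x)) - exp (- (X i * x))) / (X i - s) * n x" for x
        by (simp add: algebra_simps diff_divide_distrib)
      ultimately show ?thesis by simp
    qed
    ultimately show "((\<lambda>r. (g r - g s) / (r - s)) \<circ> X) \<longlonglongrightarrow> g' s"
      using levy_ident_integral(2)[OF s] unfolding n_def[symmetric] comp_def by (simp only:)
  qed
  moreover have "at s within {a<..} = at s" using a by (intro at_within_open) auto
  ultimately show ?thesis unfolding has_field_derivative_iff by simp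
qed

text \<open>
  Division by \<open>t\<close> is integration of the Laplace transform from \<open>s\<close> to infinity. The boundary term
  at infinity vanishes because \<open>g\<close> is unbounded.
\<close>

lemma LT_divide_ident:
  assumes [measurable]: "q \<in> borel_measurable borel" and q0: "\<And>t. t \<le> 0 \<Longrightarrow> q t = 0"
    and \<tau>: "\<tau> > 0" and s: "s > 0"
    and q: "\<And>r. r > 0 \<Longrightarrow> LT q r = ennreal (g' r * exp (- (\<tau> * g r)))"
  shows "LT (\<lambda>t. ennreal (\<tau> / t) * q t) s = ennreal (exp (- (\<tau> * g s)))"
proof -
  define f where "f r = \<tau> * enn2real (LT q r)" for r
  have [measurable]: "f \<in> borel_measurable borel" unfolding f_def by measurable
  have f: "f r = \<tau> * (g' r * exp (- (\<tau> * g r)))" "ennreal \<tau> * LT q r = ennreal (f r)" "f r \<ge> 0"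
    if "r \<ge> s" for r
  proof -
    have "g' r \<ge> 0" unfolding g'_def by simp
    moreover have qr: "LT q r = ennreal (g' r * exp (- (\<tau> * g r)))" using q[of r] that s by simp
    ultimately have e: "enn2real (LT q r) = g' r * exp (- (\<tau> * g r))" by simp
    show "f r = \<tau> * (g' r * exp (- (\<tau> * g r)))" "f r \<ge> 0"
      using \<tau> e \<open>g' r \<ge> 0\<close> unfolding f_def by auto
    show "ennreal \<tau> * LT q r = ennreal (f r)"
      unfolding f_def e unfolding qr using \<tau> by (intro ennreal_mult'[symmetric]) simp
  qed
  have "LT (\<lambda>t. ennreal (\<tau> / t) * q t) s
      = (\<integral>\<^sup>+t. \<integral>\<^sup>+r. ennreal (exp (- (r * t))) * indicator {s..} r * (ennreal \<tau> * q t) \<partial>lborel \<partial>lborel)"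
    unfolding LT_def
  proof (intro nn_integral_cong)
    fix t
    show "ennreal (exp (- (s * t))) * (ennreal (\<tau> / t) * q t)
      = (\<integral>\<^sup>+r. ennreal (exp (- (r * t))) * indicator {s..} r * (ennreal \<tau> * q t) \<partial>lborel)"
    proof (cases "t > 0")
      case True
      then have "(\<integral>\<^sup>+r. ennreal (exp (- (r * t))) * indicator {s..} r * (ennreal \<tau> * q t) \<partial>lborel)
        = ennreal (exp (- (s * t)) / t) * (ennreal \<tau> * q t)"
        by (subst nn_integral_multc) (auto simp: nn_integral_exp_atLeast)
      then show ?thesis using True by (simp add: ennreal_mult_mult)
    qed (simp add: q0)
  qed
  also have "\<dots> = (\<integral>\<^sup>+r. \<integral>\<^sup>+t. ennreal (exp (- (r * t))) * indicator {s..} r * (ennreal \<tau> * q t) \<partial>lborel \<partial>lborel)"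
    by (rule lborel_pair.Fubini'[symmetric]) measurable
  also have "\<dots> = (\<integral>\<^sup>+r. ennreal (f r) * indicator {s..} r \<partial>lborel)"
  proof (intro nn_integral_cong)
    fix r
    have "(\<integral>\<^sup>+t. ennreal (exp (- (r * t))) * indicator {s..} r * (ennreal \<tau> * q t) \<partial>lborel)
        = (\<integral>\<^sup>+t. (ennreal \<tau> * indicator {s..} r) * (ennreal (exp (- (r * t))) * q t) \<partial>lborel)"
      by (intro nn_integral_cong) (simp add: ac_simps)
    also have "\<dots> = (ennreal \<tau> * indicator {s..} r) * LT q r"
      unfolding LT_def by (rule nn_integral_cmult) measurable
    also have "\<dots> = ennreal (f r) * indicator {s..} r"
      using f(2)[of r] by (cases "r \<ge> s") simp_all
    finally show "(\<integral>\<^sup>+t. ennreal (exp (- (r * t))) * indicator {s..} r * (ennreal \<tau> * q t) \<partial>lborel)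
        = ennreal (f r) * indicator {s..} r" .
  qed
  also have "\<dots> = ennreal (0 - (- exp (- (\<tau> * g s))))"
  proof (rule nn_integral_FTC_atLeast)
    show "((\<lambda>r. - exp (- (\<tau> * g r))) has_real_derivative f r) (at r)" if "s \<le> r" for r
      using g_deriv[of r] s that unfolding f(1)[OF that] by (auto intro!: derivative_eq_intros)
    have "((\<lambda>r. - exp (- (\<tau> * g r))) \<longlongrightarrow> - 0) at_top"
      by (intro tendsto_intros filterlim_compose[OF exp_neg_mult_tendsto_0[OF \<tau>] g_top])
    then show "((\<lambda>r. - exp (- (\<tau> * g r))) \<longlongrightarrow> 0) at_top" by simp
  qed (use f(3) in auto)
  finally show ?thesis by simp
qed

text \<open>
  Differentiating \<open>exp (- \<tau> g(s))\<close> in \<open>s\<close> shows that the law with distribution function \<open>F\<close>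
  satisfies \<open>t dF = \<tau> (h * dF)\<close>, where \<open>h(x) = - x k'(x)\<close>. The right-hand side is a function even
  when \<open>dF\<close> is only a measure. To compute it from \<open>F\<close> itself, write \<open>h\<close> as the superposition of
  the functions \<open>x\<close> on \<open>[0, y]\<close> with weights \<open>k''(y)\<close>; the convolution of such a function with
  \<open>dF\<close> is, after integration by parts, the integral of \<open>F(t - x) - F(t - y)\<close> over \<open>[0, y]\<close>.
\<close>

definition increment :: "real \<Rightarrow> real \<Rightarrow> real \<Rightarrow> ennreal" where
  "increment y \<tau> t
    = (\<integral>\<^sup>+x. (subordinator_cdf \<tau> (t - x) - subordinator_cdf \<tau> (t - y)) * indicator {0..y} x \<partial>lborel)"

definition weighted_density :: "real \<Rightarrow> real \<Rightarrow> ennreal" where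
  "weighted_density \<tau> t = (\<integral>\<^sup>+y. levy_slope y * increment y \<tau> t \<partial>lborel) * indicator {0<..} t"

lemma subordinator_cdf_measurable [measurable (raw)]:
  assumes [measurable]: "a \<in> borel_measurable M" "b \<in> borel_measurable M"
  shows "(\<lambda>x. subordinator_cdf (a x) (b x)) \<in> borel_measurable M"
  using measurable_compose[OF measurable_Pair[OF assms] subordinator_cdf_measurable2] by simp

lemma increment_measurable [measurable (raw)]:
  assumes [measurable]: "a \<in> borel_measurable M" "b \<in> borel_measurable M" "c \<in> borel_measurable M"
  shows "(\<lambda>x. increment (a x) (b x) (c x)) \<in> borel_measurable M"
  unfolding increment_def by measurable

lemma weighted_density_measurable [measurable (raw)]:
  assumes [measurable]: "a \<in> borel_measurable M" "b \<in> borel_measurable M"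
  shows "(\<lambda>x. weighted_density (a x) (b x)) \<in> borel_measurable M"
  unfolding weighted_density_def by measurable

lemma LT_increment:
  assumes \<tau>: "\<tau> \<ge> 0" and s: "s > 0" and y: "y \<ge> 0"
  shows "LT (increment y \<tau>) s = ennreal (exp (- (\<tau> * g s))) *
    (\<integral>\<^sup>+x. ennreal (x * exp (- (s * x))) * indicator {0..y} x \<partial>lborel)"
proof -
  let ?F = "subordinator_cdf \<tau>"
  define e where "e = exp (- (\<tau> * g s))"
  have LF: "LT ?F s = ennreal (e / s)" unfolding e_def by (rule LT_subordinator_cdf[OF \<tau> s])
  have sum: "increment y \<tau> t + ennreal y * ?F (t - y) = (\<integral>\<^sup>+x. ?F (t - x) * indicator {0..y} x \<partial>lborel)" for t
  proof -
    have "ennreal y * ?F (t - y) = (\<integral>\<^sup>+x. ?F (t - y) * indicator {0..y} x \<partial>lborel)"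
      using y by (subst nn_integral_cmult) (auto simp: mult.commute)
    then have "increment y \<tau> t + ennreal y * ?F (t - y)
      = (\<integral>\<^sup>+x. (?F (t - x) - ?F (t - y)) * indicator {0..y} x + ?F (t - y) * indicator {0..y} x \<partial>lborel)"
      unfolding increment_def by (simp add: nn_integral_add)
    also have "\<dots> = (\<integral>\<^sup>+x. ?F (t - x) * indicator {0..y} x \<partial>lborel)"
      by (intro nn_integral_cong)
        (auto simp: indicator_def intro!: diff_add_cancel_ennreal monoD[OF mono_subordinator_cdf])
    finally show ?thesis .
  qed
  have "LT (increment y \<tau>) s + ennreal y * (ennreal (exp (- (s * y))) * LT ?F s)
      = LT (\<lambda>t. increment y \<tau> t + ennreal y * ?F (t - y)) s"
    by (subst LT_add) (auto simp: LT_cmult LT_translate)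
  also have "\<dots> = (\<integral>\<^sup>+x. LT (\<lambda>t. ?F (t - x) * indicator {0..y} x) s \<partial>lborel)"
    unfolding sum by (rule LT_nn_integral) measurable
  also have "\<dots> = (\<integral>\<^sup>+x. (ennreal (exp (- (s * x))) * indicator {0..y} x) * LT ?F s \<partial>lborel)"
    by (intro nn_integral_cong) (subst LT_multc, auto simp: LT_translate ac_simps)
  also have "\<dots> = ennreal ((1 - exp (- (s * y))) / s) * LT ?F s"
    by (subst nn_integral_multc) (auto simp: nn_integral_exp_Icc[OF s y])
  finally have "LT (increment y \<tau>) s + ennreal (y * exp (- (s * y)) * (e / s))
      = ennreal ((1 - exp (- (s * y))) / s * (e / s))"
    using y s unfolding LF by (simp add: ennreal_mult_mult e_def mult.assoc flip: ennreal_mult'')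
  also have "(1 - exp (- (s * y))) / s * (e / s)
     = e * ((1 - exp (- (s * y))) / s\<^sup>2 - y * exp (- (s * y)) / s) + y * exp (- (s * y)) * (e / s)"
    by (simp add: power2_eq_square algebra_simps diff_divide_distrib)
  also have "ennreal \<dots> = ennreal (e * ((1 - exp (- (s * y))) / s\<^sup>2 - y * exp (- (s * y)) / s))
      + ennreal (y * exp (- (s * y)) * (e / s))"
  proof (rule ennreal_plus)
    have "y * exp (- (s * y)) / s \<le> (1 - exp (- (s * y))) / s / s"
      using mult_exp_le[OF s y] s by (intro divide_right_mono) auto
    then show "0 \<le> e * ((1 - exp (- (s * y))) / s\<^sup>2 - y * exp (- (s * y)) / s)"
      by (simp add: e_def power2_eq_square)
  qed (use y s in \<open>simp add: e_def\<close>)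
  finally have "LT (increment y \<tau>) s = ennreal (e * ((1 - exp (- (s * y))) / s\<^sup>2 - y * exp (- (s * y)) / s))"
    by simp
  then show ?thesis
    unfolding nn_integral_mult_exp_Icc[OF s y] e_def by (simp add: ennreal_mult')
qed

lemma LT_weighted_density:
  assumes \<tau>: "\<tau> \<ge> 0" and s: "s > 0"
  shows "LT (weighted_density \<tau>) s = ennreal (g' s * exp (- (\<tau> * g s)))"
proof -
  define e where "e = exp (- (\<tau> * g s))"
  have "LT (weighted_density \<tau>) s = LT (\<lambda>t. \<integral>\<^sup>+y. levy_slope y * increment y \<tau> t \<partial>lborel) s"
  proof (rule LT_cong_AE)
    have zero: "increment y \<tau> t = 0" if "t < 0" for y t
      unfolding increment_def
      by (rule nn_integral_0_iff_AE[THEN iffD2], measurable)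
        (use that in \<open>auto simp: subordinator_cdf_eq_0 indicator_def\<close>)
    show "AE t in lborel. weighted_density \<tau> t = (\<integral>\<^sup>+y. levy_slope y * increment y \<tau> t \<partial>lborel)"
      using AE_lborel_singleton[of "0 :: real"]
      by eventually_elim (use zero in \<open>auto simp: weighted_density_def indicator_def\<close>)
  qed
  also have "\<dots> = (\<integral>\<^sup>+y. levy_slope y * LT (increment y \<tau>) s \<partial>lborel)"
    by (subst LT_nn_integral) (auto intro!: nn_integral_cong LT_cmult)
  also have "\<dots> = (\<integral>\<^sup>+y. ennreal e *
      (\<integral>\<^sup>+x. levy_slope y * (ennreal (x * exp (- (s * x))) * indicator {0..y} x) \<partial>lborel) \<partial>lborel)"
  proof (intro nn_integral_cong)
    fix y
    show "levy_slope y * LT (increment y \<tau>) s = ennreal e *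
      (\<integral>\<^sup>+x. levy_slope y * (ennreal (x * exp (- (s * x))) * indicator {0..y} x) \<partial>lborel)"
    proof (cases "y > 0")
      case True
      then show ?thesis
        using LT_increment[OF \<tau> s, of y] unfolding e_def
        by (subst nn_integral_cmult) (auto simp: ac_simps)
    qed (simp add: levy_slope_def)
  qed
  also have "\<dots> = ennreal e * (\<integral>\<^sup>+y. \<integral>\<^sup>+x.
      levy_slope y * (ennreal (x * exp (- (s * x))) * indicator {0..y} x) \<partial>lborel \<partial>lborel)"
    by (rule nn_integral_cmult) measurable
  also have "(\<integral>\<^sup>+y. \<integral>\<^sup>+x. levy_slope y * (ennreal (x * exp (- (s * x))) * indicator {0..y} x) \<partial>lborel \<partial>lborel)
      = (\<integral>\<^sup>+x. \<integral>\<^sup>+y. levy_slope y * (ennreal (x * exp (- (s * x))) * indicator {0..y} x) \<partial>lborel \<partial>lborel)"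
    by (rule lborel_pair.Fubini') measurable
  also have "\<dots> = LT levy_ident s"
    unfolding LT_def
  proof (intro nn_integral_cong)
    fix x
    show "(\<integral>\<^sup>+y. levy_slope y * (ennreal (x * exp (- (s * x))) * indicator {0..y} x) \<partial>lborel)
        = ennreal (exp (- (s * x))) * levy_ident x"
    proof (cases "x > 0")
      case True
      have "(\<integral>\<^sup>+y. levy_slope y * (ennreal (x * exp (- (s * x))) * indicator {0..y} x) \<partial>lborel)
          = (\<integral>\<^sup>+y. ennreal (x * exp (- (s * x))) * (levy_slope y * indicator {x..} y) \<partial>lborel)"
        using True by (intro nn_integral_cong) (auto simp: indicator_def ac_simps)
      also have "\<dots> = ennreal (x * exp (- (s * x))) * levy x"
        by (subst nn_integral_cmult) (auto simp: nn_integral_levy_slope[OF True])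
      finally show ?thesis using True by (simp add: levy_ident_def ennreal_mult_mult mult.commute[of x])
    next
      case False
      then have "ennreal (x * exp (- (s * x))) = 0"
        by (intro ennreal_neg mult_nonpos_nonneg) auto
      then show ?thesis using False by (simp add: levy_ident_def levy_def)
    qed
  qed
  finally show ?thesis
    unfolding LT_levy_ident[OF s] by (simp add: e_def ennreal_mult'' mult.commute)
qed

text \<open>A density of the subordinator at time \<open>\<tau>\<close>, from \<open>t dF = \<tau> (h * dF)\<close>.\<close>

definition density0 :: "real \<Rightarrow> real \<Rightarrow> ennreal" where
  "density0 \<tau> t = ennreal (\<tau> / t) * weighted_density \<tau> t"

lemma density0_measurable [measurable (raw)]:
  assumes [measurable]: "a \<in> borel_measurable M" "b \<in> borel_measurable M"
  shows "(\<lambda>x. density0 (a x) (b x)) \<in> borel_measurable M"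
  unfolding density0_def by measurable

lemma density0_support: "t \<le> 0 \<Longrightarrow> density0 \<tau> t = 0"
  by (simp add: density0_def weighted_density_def)

lemma LT_density0:
  assumes "\<tau> > 0" "s > 0"
  shows "LT (density0 \<tau>) s = ennreal (exp (- (\<tau> * g s)))"
  unfolding density0_def
proof (rule LT_divide_ident)
  show "weighted_density \<tau> t = 0" if "t \<le> 0" for t using that by (simp add: weighted_density_def)
qed (use assms LT_weighted_density in auto)

text \<open>
  The density is replaced by the version given by the identity \<open>t \<psi> = \<tau> (h * \<psi>)\<close>, where \<open>h\<close> is
  \<open>levy_ident\<close>: up to the factor \<open>1 / t\<close>, the subordination integrals of this version are
  convolutions of continuous functions, so that they can be evaluated at every \<open>t\<close>.
\<close>

definition subordinator_density :: "real \<Rightarrow> real \<Rightarrow> ennreal" where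
  "subordinator_density \<tau> t = ennreal (\<tau> / t) * conv levy_ident (density0 \<tau>) t"

text \<open>
  The density in \<open>\<tau>\<close> of the first time at which the subordinator exceeds \<open>t\<close>: the subordinator
  sits at some \<open>t - x\<close> just before and makes a jump larger than \<open>x\<close>, which has rate \<open>k(x)\<close>.
\<close>

definition inverse_density :: "real \<Rightarrow> real \<Rightarrow> ennreal" where
  "inverse_density \<tau> t = conv kernel (density0 \<tau>) t"

lemma subordinator_density_measurable [measurable (raw)]:
  assumes [measurable]: "a \<in> borel_measurable M" "b \<in> borel_measurable M"
  shows "(\<lambda>x. subordinator_density (a x) (b x)) \<in> borel_measurable M"
  unfolding subordinator_density_def conv_def by measurable

lemma inverse_density_measurable [measurable (raw)]:
  assumes [measurable]: "a \<in> borel_measurable M" "b \<in> borel_measurable M"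
  shows "(\<lambda>x. inverse_density (a x) (b x)) \<in> borel_measurable M"
  unfolding inverse_density_def conv_def by measurable

lemma levy_ident_support: "x \<le> 0 \<Longrightarrow> levy_ident x = 0"
  by (simp add: levy_ident_def levy_def)

lemma subordinator_density_support: "t \<le> 0 \<Longrightarrow> subordinator_density \<tau> t = 0"
  unfolding subordinator_density_def using levy_ident_support density0_support
  by (subst conv_eq_0) auto

lemma LT_subordinator_density:
  assumes "\<tau> > 0" "s > 0"
  shows "LT (subordinator_density \<tau>) s = ennreal (exp (- (\<tau> * g s)))"
  unfolding subordinator_density_def
proof (rule LT_divide_ident)
  show "conv levy_ident (density0 \<tau>) t = 0" if "t \<le> 0" for t
    using levy_ident_support density0_support that by (intro conv_eq_0) auto
  show "LT (conv levy_ident (density0 \<tau>)) r = ennreal (g' r * exp (- (\<tau> * g r)))" if "r > 0" for r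
    using assms that by (simp add: LT_conv LT_levy_ident LT_density0 ennreal_mult'')
qed (use assms in measurable)

text \<open>The total mass is the value of the Laplace transform at \<open>0\<close>, and \<open>g\<close> vanishes there.\<close>

lemma nn_integral_subordinator_density:
  assumes "\<tau> > 0"
  shows "(\<integral>\<^sup>+t. subordinator_density \<tau> t \<partial>lborel) = 1"
proof -
  define S where "S n = 1 / real (Suc n)" for n
  have S: "S n > 0" "S (Suc n) \<le> S n" for n
    unfolding S_def by (auto intro!: divide_left_mono)
  have S0: "S \<longlonglongrightarrow> 0"
    using LIMSEQ_inverse_real_of_nat unfolding S_def by (simp add: inverse_eq_divide)
  have "(\<lambda>n. LT (subordinator_density \<tau>) (S n)) \<longlonglongrightarrow> (\<integral>\<^sup>+t. subordinator_density \<tau> t \<partial>lborel)"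
    unfolding LT_def
  proof (rule nn_integral_LIMSEQ)
    show "incseq (\<lambda>n t. ennreal (exp (- (S n * t))) * subordinator_density \<tau> t)"
    proof (rule incseq_SucI, rule le_funI)
      fix n t
      show "ennreal (exp (- (S n * t))) * subordinator_density \<tau> t
        \<le> ennreal (exp (- (S (Suc n) * t))) * subordinator_density \<tau> t"
      proof (cases "t \<le> 0")
        case False
        then show ?thesis using S(2)[of n]
          by (intro mult_right_mono ennreal_leI) (auto intro: mult_right_mono)
      qed (simp add: subordinator_density_support)
    qed
    fix t
    have "(\<lambda>n. subordinator_density \<tau> t * ennreal (exp (- (S n * t)))) \<longlonglongrightarrow> subordinator_density \<tau> t * ennreal (exp (- (0 * t)))"
      by (intro tendsto_mult_ennreal tendsto_intros S0) auto
    then show "(\<lambda>n. ennreal (exp (- (S n * t))) * subordinator_density \<tau> t) \<longlonglongrightarrow> subordinator_density \<tau> t"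
      by (simp add: mult.commute)
  qed measurable
  moreover have "(\<lambda>n. LT (subordinator_density \<tau>) (S n)) \<longlonglongrightarrow> ennreal (exp (- (\<tau> * 0)))"
  proof -
    have "filterlim S (at_right 0) sequentially"
      using S0 less_imp_neq[OF S(1)] S(1) by (auto simp: filterlim_at intro!: always_eventually)
    then have "(\<lambda>n. g (S n)) \<longlonglongrightarrow> 0" by (rule filterlim_compose[OF g_zero])
    then show ?thesis
      unfolding LT_subordinator_density[OF assms S(1)] by (intro tendsto_intros)
  qed
  ultimately show ?thesis by (auto dest: LIMSEQ_unique)
qed

end

section \<open>Subordination identities\<close>

lemma LT_LT_swap:
  fixes f :: "real \<Rightarrow> real \<Rightarrow> ennreal"
  assumes [measurable]: "(\<lambda>(x, t). f x t) \<in> borel_measurable (borel \<Otimes>\<^sub>M borel)"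
  shows "LT (\<lambda>t. LT (\<lambda>\<tau>. f \<tau> t) l) s = LT (\<lambda>\<tau>. LT (f \<tau>) s) l"
proof -
  have "LT (\<lambda>t. LT (\<lambda>\<tau>. f \<tau> t) l) s = (\<integral>\<^sup>+\<tau>. LT (\<lambda>t. ennreal (exp (- (l * \<tau>))) * f \<tau> t) s \<partial>lborel)"
    unfolding LT_def[of _ l] by (rule LT_nn_integral) measurable
  also have "\<dots> = LT (\<lambda>\<tau>. LT (f \<tau>) s) l"
    unfolding LT_def[of _ l] by (intro nn_integral_cong LT_cmult) measurable
  finally show ?thesis .
qed

lemma conv_LT:
  fixes p :: "real \<Rightarrow> real \<Rightarrow> ennreal"
  assumes [measurable]: "f \<in> borel_measurable borel"
    "(\<lambda>(\<tau>, t). p \<tau> t) \<in> borel_measurable (borel \<Otimes>\<^sub>M borel)"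
  shows "conv f (\<lambda>t. LT (\<lambda>\<tau>. p \<tau> t) l) t = LT (\<lambda>\<tau>. conv f (p \<tau>) t) l"
proof -
  have "conv f (\<lambda>t. LT (\<lambda>\<tau>. p \<tau> t) l) t
      = (\<integral>\<^sup>+\<tau>. conv f (\<lambda>t. ennreal (exp (- (l * \<tau>))) * p \<tau> t) t \<partial>lborel)"
    unfolding LT_def by (rule conv_nn_integral) measurable
  also have "\<dots> = LT (\<lambda>\<tau>. conv f (p \<tau>) t) l"
    unfolding LT_def by (intro nn_integral_cong conv_cmult) measurable
  finally show ?thesis .
qed

lemma LT_mult_exp: "LT (\<lambda>\<tau>. f \<tau> * ennreal (exp (- (\<tau> * c)))) l = LT f (l + c)"
  unfolding LT_def
proof (intro nn_integral_cong)
  fix \<tau> :: real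
  have "ennreal (exp (- ((l + c) * \<tau>))) = ennreal (exp (- (l * \<tau>))) * ennreal (exp (- (\<tau> * c)))"
    by (simp add: ennreal_mult'[symmetric] exp_add[symmetric] algebra_simps)
  then show "ennreal (exp (- (l * \<tau>))) * (f \<tau> * ennreal (exp (- (\<tau> * c)))) = ennreal (exp (- ((l + c) * \<tau>))) * f \<tau>"
    by (simp add: ac_simps)
qed

context relaxation_kernel
begin

lemma half_line_continuous_kernel: "half_line_continuous kernel"
  unfolding half_line_continuous_def
proof (intro conjI)
  have "continuous_on {0<..} kernel \<longleftrightarrow> continuous_on {0<..} (\<lambda>x. ennreal (k x))"
    by (intro continuous_on_cong) (auto simp: kernel_def)
  then show "continuous_on {0<..} kernel" by (simp add: continuous_on_ennreal k_cont)
  show "LT kernel 1 < \<infinity>" using LT_k[of 1] unfolding kernel_def by simp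
  show "\<forall>t. kernel t < \<infinity>" by (simp add: kernel_def indicator_def)
  show "\<forall>t\<le>0. kernel t = 0" by (simp add: kernel_def)
qed (rule kernel_measurable)

lemma half_line_continuous_levy_ident: "half_line_continuous levy_ident"
  unfolding half_line_continuous_def
proof (intro conjI)
  have "levy_ident x = ennreal (x * - k' x)" if "x > 0" for x
    unfolding levy_ident_def levy_def using that by (subst ennreal_mult') auto
  then have "continuous_on {0<..} levy_ident \<longleftrightarrow> continuous_on {0<..} (\<lambda>x. ennreal (x * - k' x))"
    by (intro continuous_on_cong) auto
  moreover have "continuous_on {0<..} (\<lambda>x. ennreal (x * - k' x))"
    by (intro continuous_on_ennreal continuous_intros k'_cont)
  ultimately show "continuous_on {0<..} levy_ident" by simp
  show "LT levy_ident 1 < \<infinity>" by (rule LT_levy_ident_finite) simp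
  show "\<forall>t. levy_ident t < \<infinity>" by (simp add: levy_ident_def levy_def indicator_def ennreal_mult_less_top)
qed (auto simp: levy_ident_support)

lemma LT_kernel: "s > 0 \<Longrightarrow> LT kernel s = ennreal (g s / s)"
  using LT_k unfolding kernel_def[abs_def] .

lemma LT_subordination_integral:
  fixes p :: "real \<Rightarrow> real \<Rightarrow> ennreal"
  assumes [measurable]: "(\<lambda>(\<tau>, t). p \<tau> t) \<in> borel_measurable (borel \<Otimes>\<^sub>M borel)"
    "w \<in> borel_measurable borel"
    and p: "\<And>\<tau>. \<tau> > 0 \<Longrightarrow> LT (p \<tau>) s = ennreal (exp (- (\<tau> * g s)))"
    and w: "\<And>\<tau>. \<tau> \<le> 0 \<Longrightarrow> w \<tau> = 0"
  shows "LT (\<lambda>t. LT (\<lambda>\<tau>. w \<tau> * p \<tau> t) l) s = LT w (l + g s)"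
proof -
  have "LT (\<lambda>t. LT (\<lambda>\<tau>. w \<tau> * p \<tau> t) l) s = LT (\<lambda>\<tau>. LT (\<lambda>t. w \<tau> * p \<tau> t) s) l"
    by (rule LT_LT_swap) measurable
  also have "\<dots> = LT (\<lambda>\<tau>. w \<tau> * ennreal (exp (- (\<tau> * g s)))) l"
  proof (intro LT_cong_AE AE_I2)
    fix \<tau>
    have "LT (\<lambda>t. w \<tau> * p \<tau> t) s = w \<tau> * LT (p \<tau>) s" by (rule LT_cmult) measurable
    then show "LT (\<lambda>t. w \<tau> * p \<tau> t) s = w \<tau> * ennreal (exp (- (\<tau> * g s)))"
      using p[of \<tau>] w[of \<tau>] by (cases "\<tau> > 0") auto
  qed
  finally show ?thesis unfolding LT_mult_exp .
qed

lemma LT_density0_subordination: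
  assumes "l \<ge> 0" "s > 0"
  shows "LT (\<lambda>t. LT (\<lambda>\<tau>. indicator {0<..} \<tau> * density0 \<tau> t) l) s = ennreal (1 / (g s + l))"
  using g_pos[OF assms(2)] assms
  by (subst LT_subordination_integral) (auto simp: LT_density0 LT_step_Ioi add.commute)

text \<open>
  Here \<open>V\<close> is the impulse-response solution for the parameter \<open>l\<close>, characterised by its Laplace
  transform. By uniqueness it is the integral of the densities over \<open>\<tau>\<close> with weight \<open>exp (- l \<tau>)\<close>,
  at almost every \<open>t\<close>; convolving with a function removes the exceptional set.
\<close>

context
  fixes l :: real and V :: "real \<Rightarrow> ennreal"
  assumes l: "l \<ge> 0" and V: "half_line_continuous V"
    and LT_V: "\<And>s. s > 0 \<Longrightarrow> LT V s = ennreal (1 / (g s + l))"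
begin

lemma V_measurable [measurable]: "V \<in> borel_measurable borel"
  using V by (rule half_line_continuousD)

lemma density0_subordination:
  "AE t in lborel. LT (\<lambda>\<tau>. indicator {0<..} \<tau> * density0 \<tau> t) l = V t"
proof (rule LT_unique)
  show "LT (\<lambda>t. LT (\<lambda>\<tau>. indicator {0<..} \<tau> * density0 \<tau> t) l) s = LT V s"
    "LT (\<lambda>t. LT (\<lambda>\<tau>. indicator {0<..} \<tau> * density0 \<tau> t) l) s < \<infinity>" if s: "s > 0" for s
    using LT_density0_subordination[OF l s] LT_V[OF s] by simp_all
  show "(\<lambda>t. LT (\<lambda>\<tau>. indicator {0<..} \<tau> * density0 \<tau> t) l) \<in> borel_measurable borel"
    unfolding LT_def by measurable
qed (use half_line_continuousD(2)[OF V] in \<open>auto simp: density0_support LT_def\<close>)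

lemma inverse_density_subordination:
  "LT (\<lambda>\<tau>. indicator {0<..} \<tau> * inverse_density \<tau> t) l = conv kernel V t"
proof -
  have "LT (\<lambda>\<tau>. indicator {0<..} \<tau> * inverse_density \<tau> t) l
      = LT (\<lambda>\<tau>. conv kernel (\<lambda>t. indicator {0<..} \<tau> * density0 \<tau> t) t) l"
    unfolding inverse_density_def
    by (intro LT_cong_AE AE_I2 conv_cmult[symmetric]) measurable
  also have "\<dots> = conv kernel (\<lambda>t. LT (\<lambda>\<tau>. indicator {0<..} \<tau> * density0 \<tau> t) l) t"
    by (rule conv_LT[symmetric]) measurable
  also have "\<dots> = conv kernel V t"
    by (rule conv_cong_AE[OF _ _ _ density0_subordination]) (unfold LT_def, measurable)
  finally show ?thesis .
qed

text \<open>The weight \<open>\<tau> exp (- l \<tau>)\<close> produces \<open>1 / (g(s) + l)\<^sup>2\<close>, the transform of \<open>V * V\<close>.\<close>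

lemma density0_weighted_subordination:
  "AE t in lborel. LT (\<lambda>\<tau>. ennreal \<tau> * indicator {0<..} \<tau> * density0 \<tau> t) l = conv V V t"
proof (rule LT_unique)
  show "LT (\<lambda>t. LT (\<lambda>\<tau>. ennreal \<tau> * indicator {0<..} \<tau> * density0 \<tau> t) l) s = LT (conv V V) s"
    "LT (\<lambda>t. LT (\<lambda>\<tau>. ennreal \<tau> * indicator {0<..} \<tau> * density0 \<tau> t) l) s < \<infinity>" if s: "s > 0" for s
  proof -
    have "LT (\<lambda>t. LT (\<lambda>\<tau>. ennreal \<tau> * indicator {0<..} \<tau> * density0 \<tau> t) l) s
        = ennreal (1 / (l + g s)\<^sup>2)"
      using g_pos[OF s] l s
      by (subst LT_subordination_integral) (auto simp: LT_density0 LT_ident)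
    also have "\<dots> = ennreal (1 / (g s + l)) * ennreal (1 / (g s + l))"
      using g_pos[OF s] l by (simp add: ennreal_mult'[symmetric] power2_eq_square add.commute)
    finally show "LT (\<lambda>t. LT (\<lambda>\<tau>. ennreal \<tau> * indicator {0<..} \<tau> * density0 \<tau> t) l) s = LT (conv V V) s"
      "LT (\<lambda>t. LT (\<lambda>\<tau>. ennreal \<tau> * indicator {0<..} \<tau> * density0 \<tau> t) l) s < \<infinity>"
      by (simp_all add: LT_V[OF s] LT_conv ennreal_mult_less_top)
  qed
  show "(\<lambda>t. LT (\<lambda>\<tau>. ennreal \<tau> * indicator {0<..} \<tau> * density0 \<tau> t) l) \<in> borel_measurable borel"
    unfolding LT_def by measurable
  show "conv V V t = 0" if "t < 0" for t
    using half_line_continuousD(2)[OF V] that by (intro conv_eq_0) auto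
qed (auto simp: density0_support LT_def)

lemma subordinator_density_subordination_conv:
  assumes t: "t > 0"
  shows "LT (\<lambda>\<tau>. indicator {0<..} \<tau> * subordinator_density \<tau> t) l
    = ennreal (1 / t) * conv levy_ident (conv V V) t"
proof -
  have "LT (\<lambda>\<tau>. indicator {0<..} \<tau> * subordinator_density \<tau> t) l
      = LT (\<lambda>\<tau>. ennreal (1 / t) * conv levy_ident (\<lambda>t. ennreal \<tau> * indicator {0<..} \<tau> * density0 \<tau> t) t) l"
  proof (intro LT_cong_AE AE_I2)
    fix \<tau> :: real
    show "indicator {0<..} \<tau> * subordinator_density \<tau> t
      = ennreal (1 / t) * conv levy_ident (\<lambda>t. ennreal \<tau> * indicator {0<..} \<tau> * density0 \<tau> t) t"
      unfolding subordinator_density_def using t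
      by (subst conv_cmult) (auto simp: indicator_def ennreal_mult_mult conv_def)
  qed
  also have "\<dots> = ennreal (1 / t) * LT (\<lambda>\<tau>. conv levy_ident (\<lambda>t. ennreal \<tau> * indicator {0<..} \<tau> * density0 \<tau> t) t) l"
    by (rule LT_cmult) (unfold conv_def, measurable)
  also have "LT (\<lambda>\<tau>. conv levy_ident (\<lambda>t. ennreal \<tau> * indicator {0<..} \<tau> * density0 \<tau> t) t) l
      = conv levy_ident (\<lambda>t. LT (\<lambda>\<tau>. ennreal \<tau> * indicator {0<..} \<tau> * density0 \<tau> t) l) t"
    by (rule conv_LT[symmetric]) measurable
  also have "\<dots> = conv levy_ident (conv V V) t"
    by (rule conv_cong_AE[OF _ _ _ density0_weighted_subordination]) (unfold LT_def, measurable)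
  finally show ?thesis .
qed

text \<open>
  Both sides have the same Laplace transform in \<open>t\<close>, hence agree almost everywhere. The previous
  lemma represents the left-hand side by a convolution of continuous functions, which makes it
  continuous in \<open>t\<close>, and so the two sides agree for all \<open>t\<close>.
\<close>

lemma subordinator_density_subordination:
  assumes t: "t > 0"
  shows "LT (\<lambda>\<tau>. indicator {0<..} \<tau> * subordinator_density \<tau> t) l = V t"
proof -
  define A where "A t = LT (\<lambda>\<tau>. indicator {0<..} \<tau> * subordinator_density \<tau> t) l" for t
  have AE: "AE t in lborel. A t = V t"
  proof (rule LT_unique)
    show "LT A s = LT V s" "LT A s < \<infinity>" if s: "s > 0" for s
    proof -
      have "LT A s = ennreal (1 / (l + g s))"
        unfolding A_def[abs_def] using g_pos[OF s] l s
        by (subst LT_subordination_integral) (auto simp: LT_subordinator_density LT_step_Ioi)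
      then show "LT A s = LT V s" "LT A s < \<infinity>" by (simp_all add: LT_V[OF s] add.commute)
    qed
    show "A \<in> borel_measurable borel" unfolding A_def[abs_def] LT_def by measurable
  qed (use half_line_continuousD(2)[OF V] in \<open>auto simp: A_def LT_def subordinator_density_support\<close>)
  have hV: "half_line_continuous (conv levy_ident (conv V V))"
    by (intro half_line_continuous_conv half_line_continuous_levy_ident V)
  have "continuous_on {0<..} (\<lambda>t. ennreal (1 / t) * conv levy_ident (conv V V) t)"
    unfolding continuous_on_def
  proof (intro ballI tendsto_mult_ennreal)
    fix x :: real assume x: "x \<in> {0<..}"
    show "((\<lambda>t. ennreal (1 / t)) \<longlongrightarrow> ennreal (1 / x)) (at x within {0<..})"
      using x by (intro tendsto_intros) auto
    show "(conv levy_ident (conv V V) \<longlongrightarrow> conv levy_ident (conv V V) x) (at x within {0<..})"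
      using half_line_continuousD(3)[OF hV] x unfolding continuous_on_def by blast
    show "\<not> (ennreal (1 / x) = 0 \<and> conv levy_ident (conv V V) x = \<infinity> \<or>
        ennreal (1 / x) = \<infinity> \<and> conv levy_ident (conv V V) x = 0)"
      using half_line_continuousD(4)[OF hV, of x] by auto
  qed
  moreover have "AE t in lborel. t > 0 \<longrightarrow> ennreal (1 / t) * conv levy_ident (conv V V) t = V t"
    using AE by eventually_elim (auto simp: A_def subordinator_density_subordination_conv)
  ultimately have "ennreal (1 / t) * conv levy_ident (conv V V) t = V t"
    using t by (intro continuous_AE_eq_imp_eq[OF _ half_line_continuousD(3)[OF V]])
  then show ?thesis unfolding subordinator_density_subordination_conv[OF t] .
qed

end

end

section \<open>From Lebesgue integrals of real functions to nonnegative integrals\<close>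

lemma set_integral_enn2real:
  fixes p :: "real \<Rightarrow> ennreal"
  assumes [measurable]: "p \<in> borel_measurable borel"
    and int: "(\<integral>\<^sup>+x. indicator {0<..} x * p x \<partial>lborel) = ennreal c" and c: "c \<ge> 0"
  shows "set_integrable lebesgue {0<..} (\<lambda>x. enn2real (p x))"
    and "(LINT x:{0<..}|lebesgue. enn2real (p x)) = c"
proof -
  define f where "f x = indicator {0<..} x *\<^sub>R enn2real (p x)" for x :: real
  have [measurable]: "f \<in> borel_measurable borel" unfolding f_def by measurable
  have "AE x in lborel. indicator {0<..} x * p x \<noteq> \<infinity>"
    using int by (intro nn_integral_PInf_AE) auto
  then have "AE x in lborel. ennreal (f x) = indicator {0<..} x * p x"
    by eventually_elim (auto simp: f_def indicator_def less_top)
  then have fc: "(\<integral>\<^sup>+x. ennreal (f x) \<partial>lborel) = ennreal c"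
    unfolding int[symmetric] by (rule nn_integral_cong_AE)
  have nn: "f x \<ge> 0" for x unfolding f_def by simp
  have "integrable lborel f" by (rule integrableI_nn_integral_finite[OF _ _ fc]) (use nn in auto)
  then show "set_integrable lebesgue {0<..} (\<lambda>x. enn2real (p x))"
    unfolding set_integrable_def f_def[symmetric] by (subst integrable_completion) auto
  have "integral\<^sup>L lborel f = c"
    using nn fc c by (subst integral_eq_nn_integral) auto
  then show "(LINT x:{0<..}|lebesgue. enn2real (p x)) = c"
    unfolding set_lebesgue_integral_def f_def[symmetric] by (subst integral_completion) auto
qed

definition half_line_ennreal :: "(real \<Rightarrow> real) \<Rightarrow> real \<Rightarrow> ennreal" where
  "half_line_ennreal f t = ennreal (f t) * indicator {0<..} t"

lemma half_line_ennreal_measurable: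
  assumes "continuous_on {0<..} f"
  shows "half_line_ennreal f \<in> borel_measurable borel"
  unfolding half_line_ennreal_def[abs_def] using assms by (rule measurable_Ioi)

lemma laplace_eq_LT_diff:
  assumes f: "continuous_on {0<..} f" and ex: "laplace_exists f s"
  shows "LT (half_line_ennreal f) s < \<infinity>" "LT (half_line_ennreal (\<lambda>t. - f t)) s < \<infinity>"
    and "laplace f s = enn2real (LT (half_line_ennreal f) s) - enn2real (LT (half_line_ennreal (\<lambda>t. - f t)) s)"
proof -
  define h where "h t = indicator {0<..} t *\<^sub>R (exp (- s * t) * f t)" for t
  have [measurable]: "h \<in> borel_measurable borel"
    unfolding h_def by (rule borel_measurable_continuous_on_indicator) (auto intro!: continuous_intros f)
  have int: "integrable lborel h"
    using ex unfolding laplace_exists_def set_integrable_def h_def[symmetric]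
    by (subst (asm) integrable_completion) auto
  have pos: "(\<integral>\<^sup>+t. ennreal (h t) \<partial>lborel) = LT (half_line_ennreal f) s"
    unfolding LT_def half_line_ennreal_def h_def
    by (intro nn_integral_cong) (auto simp: indicator_def ennreal_mult')
  have neg: "(\<integral>\<^sup>+t. ennreal (- h t) \<partial>lborel) = LT (half_line_ennreal (\<lambda>t. - f t)) s"
    unfolding LT_def half_line_ennreal_def h_def
    by (intro nn_integral_cong) (auto simp: indicator_def ennreal_mult'[symmetric])
  show "LT (half_line_ennreal f) s < \<infinity>" "LT (half_line_ennreal (\<lambda>t. - f t)) s < \<infinity>"
    using int unfolding real_integrable_def pos neg by (auto simp: less_top)
  have "laplace f s = integral\<^sup>L lborel h"
    unfolding laplace_def set_lebesgue_integral_def h_def[symmetric] by (subst integral_completion) auto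
  then show "laplace f s = enn2real (LT (half_line_ennreal f) s) - enn2real (LT (half_line_ennreal (\<lambda>t. - f t)) s)"
    using real_lebesgue_integral_def[OF int] unfolding pos neg by simp
qed

lemma LT_half_line_ennreal:
  assumes "continuous_on {0<..} f" "laplace_exists f s" "\<And>t. t > 0 \<Longrightarrow> f t \<ge> 0"
  shows "LT (half_line_ennreal f) s = ennreal (laplace f s)" "laplace f s \<ge> 0"
proof -
  have "half_line_ennreal (\<lambda>t. - f t) = (\<lambda>t. 0)"
    using assms(3) by (auto simp: half_line_ennreal_def indicator_def ennreal_neg fun_eq_iff)
  then have "LT (half_line_ennreal (\<lambda>t. - f t)) s = 0" by (simp add: LT_def)
  then show "LT (half_line_ennreal f) s = ennreal (laplace f s)" "laplace f s \<ge> 0"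
    using laplace_eq_LT_diff[OF assms(1,2)] by simp_all
qed

text \<open>
  The real function \<open>f\<close> may change sign a priori: uniqueness is applied to the positive part of \<open>f\<close>
  and to the sum of \<open>W\<close> and the negative part.
\<close>

lemma laplace_unique_nonneg:
  assumes f: "continuous_on {0<..} f" and ex: "\<And>s. s > 0 \<Longrightarrow> laplace_exists f s"
    and [measurable]: "W \<in> borel_measurable borel" and W0: "\<And>t. t \<le> 0 \<Longrightarrow> W t = 0"
    and W: "\<And>s. s > 0 \<Longrightarrow> LT W s = ennreal (laplace f s)" "\<And>s. s > 0 \<Longrightarrow> laplace f s \<ge> 0"
  shows "AE t in lborel. t > 0 \<longrightarrow> f t \<ge> 0 \<and> W t = ennreal (f t)"
proof -
  let ?P = "half_line_ennreal f" and ?N = "half_line_ennreal (\<lambda>t. - f t)"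
  note [measurable] = half_line_ennreal_measurable[OF f]
    half_line_ennreal_measurable[OF continuous_on_minus[OF f]]
  have "AE t in lborel. ?P t = ?N t + W t"
  proof (rule LT_unique)
    show "?P \<in> borel_measurable borel" "(\<lambda>t. ?N t + W t) \<in> borel_measurable borel"
      by measurable
    show "?P t = 0" "?N t + W t = 0" if "t < 0" for t
      using W0[of t] that by (simp_all add: half_line_ennreal_def)
    fix s :: real assume s: "s > 0"
    note * = laplace_eq_LT_diff[OF f ex[OF s]]
    show "LT ?P s < \<infinity>" by (rule *)
    obtain p n where pn: "LT ?P s = ennreal p" "p \<ge> 0" "LT ?N s = ennreal n" "n \<ge> 0"
      using *(1,2) by (metis ennreal_cases infinity_ennreal_def less_irrefl)
    then show "LT ?P s = LT (\<lambda>t. ?N t + W t) s"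
      using *(3) W(1,2)[OF s] by (simp add: LT_add flip: ennreal_plus)
  qed
  then show ?thesis
  proof eventually_elim
    case (elim t)
    show ?case
    proof
      assume t: "t > 0"
      then have eq: "ennreal (f t) = ennreal (- f t) + W t" using elim by (simp add: half_line_ennreal_def)
      have "f t \<ge> 0"
      proof (rule ccontr)
        assume "\<not> f t \<ge> 0"
        then have "ennreal (f t) = 0" "ennreal (- f t) > 0" by (auto simp: ennreal_neg)
        then show False using eq by simp
      qed
      then show "f t \<ge> 0 \<and> W t = ennreal (f t)" using eq by (simp add: ennreal_neg)
    qed
  qed
qed

lemma laplace_unique_continuous:
  assumes f: "continuous_on {0<..} f" and ex: "\<And>s. s > 0 \<Longrightarrow> laplace_exists f s"
    and W: "half_line_continuous W"
    and LW: "\<And>s. s > 0 \<Longrightarrow> LT W s = ennreal (laplace f s)" "\<And>s. s > 0 \<Longrightarrow> laplace f s \<ge> 0"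
    and t: "t > 0"
  shows "f t \<ge> 0" "W t = ennreal (f t)"
proof -
  have AE: "AE t in lborel. t > 0 \<longrightarrow> f t \<ge> 0 \<and> W t = ennreal (f t)"
    by (rule laplace_unique_nonneg[OF f ex _ _ LW]) (use half_line_continuousD[OF W] in auto)
  have "f t = \<bar>f t\<bar>"
  proof (rule continuous_AE_eq_imp_eq[OF f _ _ t])
    show "continuous_on {0<..} (\<lambda>t. \<bar>f t\<bar>)" by (intro continuous_intros f)
    show "AE t in lborel. t > 0 \<longrightarrow> f t = \<bar>f t\<bar>" using AE by eventually_elim auto
  qed
  then show "f t \<ge> 0" by simp
  show "W t = ennreal (f t)"
  proof (rule continuous_AE_eq_imp_eq[OF half_line_continuousD(3)[OF W] _ _ t])
    show "continuous_on {0<..} (\<lambda>t. ennreal (f t))" by (intro continuous_on_ennreal f)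
    show "AE t in lborel. t > 0 \<longrightarrow> W t = ennreal (f t)" using AE by eventually_elim auto
  qed
qed

section \<open>Stieltjes kernels\<close>

lemma completely_monotone_derivs:
  assumes "completely_monotone f" "x > 0"
  shows "f x \<ge> 0" "(f has_real_derivative deriv f x) (at x)" "deriv f x \<le> 0"
    "(deriv f has_real_derivative deriv (deriv f) x) (at x)" "deriv (deriv f) x \<ge> 0"
    "isCont (deriv (deriv f)) x"
proof -
  have d: "(deriv ^^ n) f differentiable (at x)" and s: "(- 1) ^ n * (deriv ^^ n) f x \<ge> 0" for n
    using assms unfolding completely_monotone_def by auto
  show "f x \<ge> 0" using s[of 0] by simp
  show "deriv f x \<le> 0" using s[of 1] by simp
  show "deriv (deriv f) x \<ge> 0" using s[of 2] by (simp add: eval_nat_numeral)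
  show "(f has_real_derivative deriv f x) (at x)"
    using d[of 0] by (simp add: DERIV_deriv_iff_real_differentiable)
  show "(deriv f has_real_derivative deriv (deriv f) x) (at x)"
    using d[of 1] by (simp add: DERIV_deriv_iff_real_differentiable)
  show "isCont (deriv (deriv f)) x"
    using d[of 2] by (simp add: eval_nat_numeral differentiable_imp_continuous_within)
qed

text \<open>
  The limit at infinity excludes the constant \<open>b\<close> of the Stieltjes representation, and the limit of
  \<open>s K(s)\<close> at \<open>0\<close> excludes both the term \<open>a / s\<close> and a positive limit of the density \<open>\<psi>\<close> at
  infinity. So \<open>K\<close> is the Laplace transform of \<open>\<psi>\<close>, and \<open>\<psi>\<close> takes the role of the kernel.
\<close>

lemma stieltjes_relaxation_kernel:
  assumes st: "stieltjes_function K"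
    and K_top: "(K \<longlongrightarrow> 0) at_top"
    and sK_top: "filterlim (\<lambda>s. s * K s) at_top at_top"
    and sK_zero: "((\<lambda>s. s * K s) \<longlongrightarrow> 0) (at_right 0)"
  obtains \<psi> where "relaxation_kernel \<psi> (deriv \<psi>) (deriv (deriv \<psi>)) (\<lambda>s. s * K s)"
proof -
  obtain a b \<psi> where ab: "a \<ge> 0" "b \<ge> 0" and cm: "completely_monotone \<psi>"
    and ex: "\<And>s. s > 0 \<Longrightarrow> laplace_exists \<psi> s"
    and K: "\<And>s. s > 0 \<Longrightarrow> K s = a / s + b + laplace \<psi> s"
    using st unfolding stieltjes_function_def by auto
  note d = completely_monotone_derivs[OF cm]
  have c: "continuous_on {0<..} \<psi>"
    by (auto intro!: continuous_at_imp_continuous_on DERIV_isCont[OF d(2)])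
  note LT\<psi> = LT_half_line_ennreal[OF c ex d(1)]
  have "b \<le> 0"
  proof (rule tendsto_lowerbound[OF K_top])
    show "\<forall>\<^sub>F s in at_top. b \<le> K s"
      using eventually_gt_at_top[of 0]
      by eventually_elim (use K LT\<psi>(2) ab in \<open>auto intro!: add_increasing2 add_increasing\<close>)
  qed simp
  have "a \<le> 0"
  proof (rule tendsto_lowerbound[OF sK_zero])
    show "\<forall>\<^sub>F s in at_right 0. a \<le> s * K s"
      using eventually_at_right_less[of 0]
    proof eventually_elim
      fix s :: real assume s: "0 < s"
      then have "s * K s = a + s * (b + laplace \<psi> s)" by (simp add: K distrib_left)
      then show "a \<le> s * K s" using s ab LT\<psi>(2)[OF s] by simp
    qed
  qed simp
  with \<open>b \<le> 0\<close> ab have K\<psi>: "K s = laplace \<psi> s" if "s > 0" for s using K[OF that] by simp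
  have LTK: "LT (half_line_ennreal \<psi>) s = ennreal (K s)" "K s \<ge> 0" if "s > 0" for s
    using LT\<psi>[OF that] K\<psi>[OF that] by simp_all
  have anti: "\<psi> y \<le> \<psi> x" if "0 < x" "x \<le> y" for x y
  proof (rule DERIV_nonpos_imp_nonincreasing[OF that(2)])
    fix z assume "x \<le> z"
    then show "\<exists>y. (\<psi> has_real_derivative y) (at z) \<and> y \<le> 0"
      using d(2,3)[of z] that by (intro exI[of _ "deriv \<psi> z"]) auto
  qed
  have small: "\<exists>x>0. \<psi> x < e" if e: "e > 0" for e
  proof (rule ccontr)
    assume "\<not> (\<exists>x>0. \<psi> x < e)"
    then have ge: "\<psi> x \<ge> e" if "x > 0" for x using that by force
    have "e \<le> s * K s" if s: "s > 0" for s
    proof -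
      have "ennreal e * LT (indicator {0<..}) s \<le> LT (half_line_ennreal \<psi>) s"
        unfolding LT_def half_line_ennreal_def
        by (subst nn_integral_cmult[symmetric], measurable, rule nn_integral_mono)
          (auto simp: indicator_def mult.commute ge intro!: mult_right_mono ennreal_leI)
      then have "ennreal (e / s) \<le> ennreal (K s)"
        unfolding LT_step_Ioi[OF s] LTK(1)[OF s] using e by (simp flip: ennreal_mult')
      then have "e / s \<le> K s" using LTK(2)[OF s] by (simp add: ennreal_le_iff)
      then show ?thesis using s by (simp add: pos_divide_le_eq mult.commute)
    qed
    then have "\<forall>\<^sub>F s in at_right 0. e \<le> s * K s"
      using eventually_at_right_less[of 0] by (auto elim: eventually_mono)
    then have "e \<le> 0" by (intro tendsto_lowerbound[OF sK_zero]) auto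
    then show False using e by simp
  qed
  show ?thesis
  proof (rule that, unfold_locales)
    show "(\<psi> has_real_derivative deriv \<psi> x) (at x)" "(deriv \<psi> has_real_derivative deriv (deriv \<psi>) x) (at x)"
      "\<psi> x \<ge> 0" "deriv \<psi> x \<le> 0" "deriv (deriv \<psi>) x \<ge> 0" if "x > 0" for x
      by (fact d[OF that])+
    show "continuous_on {0<..} (deriv (deriv \<psi>))"
      by (auto intro!: continuous_at_imp_continuous_on d(6))
    show "(\<psi> \<longlongrightarrow> 0) at_top"
    proof (rule order_tendstoI)
      fix e :: real assume "e < 0"
      show "\<forall>\<^sub>F x in at_top. e < \<psi> x"
        using eventually_gt_at_top[of 0] by eventually_elim (use \<open>e < 0\<close> d(1) in \<open>force\<close>)
    next
      fix e :: real assume "e > 0"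
      then obtain x where "x > 0" "\<psi> x < e" using small by auto
      show "\<forall>\<^sub>F x in at_top. \<psi> x < e"
        using eventually_ge_at_top[of x] by eventually_elim (use anti[OF \<open>x > 0\<close>] \<open>\<psi> x < e\<close> in force)
    qed
    show "LT (\<lambda>x. ennreal (\<psi> x) * indicator {0<..} x) s = ennreal (s * K s / s)" if "s > 0" for s
      using LTK(1)[OF that] that unfolding half_line_ennreal_def[abs_def] by simp
    show "s * K s > 0" if s: "s > 0" for s
    proof (rule ccontr)
      assume "\<not> s * K s > 0"
      then have Ks: "K s = 0" using s LTK(2)[OF s] by (simp add: zero_less_mult_iff)
      have Kr: "K r = 0" if "r \<ge> s" for r
      proof -
        have "LT (half_line_ennreal \<psi>) r \<le> LT (half_line_ennreal \<psi>) s"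
          unfolding LT_def
        proof (rule nn_integral_mono)
          fix x
          show "ennreal (exp (- (r * x))) * half_line_ennreal \<psi> x \<le> ennreal (exp (- (s * x))) * half_line_ennreal \<psi> x"
            using that by (cases "x > 0") (auto simp: half_line_ennreal_def intro!: mult_right_mono ennreal_leI)
        qed
        then show ?thesis using LTK[of r] LTK[of s] s that Ks by simp
      qed
      have "\<forall>\<^sub>F r in at_top. s \<le> r \<and> 1 \<le> r * K r"
        using sK_top by (intro eventually_conj eventually_ge_at_top) (simp add: filterlim_at_top)
      then obtain r where "s \<le> r" "1 \<le> r * K r"
        using eventually_happens'[OF trivial_limit_at_top_linorder] by blast
      then show False using Kr by simp
    qed
    show "filterlim (\<lambda>s. s * K s) at_top at_top" "((\<lambda>s. s * K s) \<longlongrightarrow> 0) (at_right 0)"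
      by (fact sK_top sK_zero)+
  qed
qed

section \<open>The subordination theorem\<close>

theorem theorem2p1:
  fixes k :: "real \<Rightarrow> real"
    and u v :: "real \<Rightarrow> real \<Rightarrow> real"
  assumes "locally_integrable_Rplus k"
    and "\<And>t. t > 0 \<Longrightarrow> k t \<ge> 0"
    and "\<And>s. s > 0 \<Longrightarrow> laplace_exists k s"
    and "stieltjes_function (laplace k)"
    and "(laplace k \<longlongrightarrow> 0) at_top"
    and "filterlim (\<lambda>s. s * laplace k s) at_top at_top"
    and "filterlim (laplace k) at_top (at_right 0)"
    and "((\<lambda>s. s * laplace k s) \<longlongrightarrow> 0) (at_right 0)"
    and "\<And>l. l \<ge> 0 \<Longrightarrow> fundamental_solution k l (\<lambda>t. u t l)"
    and "\<And>l. l \<ge> 0 \<Longrightarrow> impulse_response_solution k l (\<lambda>t. v t l)"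
  shows "\<exists>\<phi> \<psi> :: real \<Rightarrow> real \<Rightarrow> real.
    (\<forall>l\<ge>0. \<forall>t>0.
       set_integrable lebesgue {0<..} (\<lambda>\<tau>. \<phi> t \<tau> * exp (- l * \<tau>)) \<and>
       u t l = (LINT \<tau>:{0<..}|lebesgue. \<phi> t \<tau> * exp (- l * \<tau>)) \<and>
       set_integrable lebesgue {0<..} (\<lambda>\<tau>. \<psi> t \<tau> * exp (- l * \<tau>)) \<and>
       v t l = (LINT \<tau>:{0<..}|lebesgue. \<psi> t \<tau> * exp (- l * \<tau>))) \<and>
    (\<forall>t>0. \<forall>\<tau>>0. \<phi> t \<tau> \<ge> 0 \<and> \<psi> t \<tau> \<ge> 0) \<and>
    (\<forall>t>0. set_integrable lebesgue {0<..} (\<lambda>\<tau>. \<phi> t \<tau>) \<and>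
       (LINT \<tau>:{0<..}|lebesgue. \<phi> t \<tau>) = 1) \<and>
    (\<forall>\<tau>>0. set_integrable lebesgue {0<..} (\<lambda>t. \<psi> t \<tau>) \<and>
       (LINT t:{0<..}|lebesgue. \<psi> t \<tau>) = 1)"
proof -
  define g where "g s = s * laplace k s" for s
  obtain k\<^sub>0 where "relaxation_kernel k\<^sub>0 (deriv k\<^sub>0) (deriv (deriv k\<^sub>0)) (\<lambda>s. s * laplace k s)"
    using stieltjes_relaxation_kernel[OF assms(4,5,6,8)] by blast
  then interpret relaxation_kernel k\<^sub>0 "deriv k\<^sub>0" "deriv (deriv k\<^sub>0)" g
    unfolding g_def[abs_def] .
  define \<phi> where "\<phi> t \<tau> = enn2real (inverse_density \<tau> t)" for t \<tau>
  define \<psi> where "\<psi> t \<tau> = enn2real (subordinator_density \<tau> t)" for t \<tau>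
  define V where "V l = half_line_ennreal (\<lambda>t. v t l)" for l
  have u: "continuous_on {0<..} (\<lambda>t. u t l)" "\<And>s. s > 0 \<Longrightarrow> laplace_exists (\<lambda>t. u t l) s"
      "\<And>s. s > 0 \<Longrightarrow> laplace (\<lambda>t. u t l) s = g s / (s * (g s + l))" if "l \<ge> 0" for l
    using assms(9)[OF that] unfolding fundamental_solution_def relaxation_symbol_def g_def
    by (auto elim: continuous_on_subset)
  have v: "continuous_on {0<..} (\<lambda>t. v t l)" "\<And>s. s > 0 \<Longrightarrow> laplace_exists (\<lambda>t. v t l) s"
      "\<And>s. s > 0 \<Longrightarrow> laplace (\<lambda>t. v t l) s = 1 / (g s + l)" if "l \<ge> 0" for l
    using assms(10)[OF that] unfolding impulse_response_solution_def relaxation_symbol_def g_def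
    by auto
  \<comment> \<open>\<open>v\<close> is almost everywhere an integral of densities, and it is continuous.\<close>
  have v_nonneg: "v t l \<ge> 0" if l: "l \<ge> 0" and t: "t > 0" for l t
  proof -
    have "AE t in lborel. t > 0 \<longrightarrow> v t l \<ge> 0 \<and>
        LT (\<lambda>\<tau>. indicator {0<..} \<tau> * density0 \<tau> t) l = ennreal (v t l)"
    proof (rule laplace_unique_nonneg[OF v(1,2)[OF l]])
      show "(\<lambda>t. LT (\<lambda>\<tau>. indicator {0<..} \<tau> * density0 \<tau> t) l) \<in> borel_measurable borel"
        unfolding LT_def by measurable
      show "LT (\<lambda>t. LT (\<lambda>\<tau>. indicator {0<..} \<tau> * density0 \<tau> t) l) s = ennreal (laplace (\<lambda>t. v t l) s)"
        if "s > 0" for s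
        using LT_density0_subordination[OF l that] v(3)[OF l that] by simp
      show "laplace (\<lambda>t. v t l) s \<ge> 0" if "s > 0" for s
        using v(3)[OF l that] g_pos[OF that] l by simp
    qed (auto simp: density0_support LT_def)
    then have "AE t in lborel. t > 0 \<longrightarrow> v t l = \<bar>v t l\<bar>" by eventually_elim auto
    then have "v t l = \<bar>v t l\<bar>"
      by (intro continuous_AE_eq_imp_eq[OF v(1)[OF l] _ _ t] continuous_intros v(1)[OF l])
    then show ?thesis by simp
  qed
  have LT_V: "LT (V l) s = ennreal (1 / (g s + l))" if "l \<ge> 0" "s > 0" for l s
    using LT_half_line_ennreal(1)[OF v(1,2) v_nonneg] v(3) that unfolding V_def by simp
  have V: "half_line_continuous (V l)" if l: "l \<ge> 0" for l
    unfolding half_line_continuous_def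
  proof (intro conjI)
    show "V l \<in> borel_measurable borel"
      unfolding V_def by (rule half_line_ennreal_measurable[OF v(1)[OF l]])
    have "continuous_on {0<..} (V l) \<longleftrightarrow> continuous_on {0<..} (\<lambda>t. ennreal (v t l))"
      by (intro continuous_on_cong) (auto simp: V_def half_line_ennreal_def)
    then show "continuous_on {0<..} (V l)" using v(1)[OF l] by (simp add: continuous_on_ennreal)
    show "LT (V l) 1 < \<infinity>" using LT_V[OF l, of 1] by simp
  qed (auto simp: V_def half_line_ennreal_def indicator_def)
  have conv_u: "u t l \<ge> 0" "conv kernel (V l) t = ennreal (u t l)" if l: "l \<ge> 0" and t: "t > 0" for l t
  proof -
    have hc: "half_line_continuous (conv kernel (V l))"
      by (intro half_line_continuous_conv half_line_continuous_kernel V[OF l])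
    have nn: "laplace (\<lambda>t. u t l) s \<ge> 0" if "s > 0" for s
      using u(3)[OF l that] g_pos[OF that] that l by simp
    have "LT (conv kernel (V l)) s = ennreal (laplace (\<lambda>t. u t l) s)" if "s > 0" for s
      using half_line_continuousD(1)[OF V[OF l]] g_pos[OF that] that l
      by (simp add: LT_conv LT_kernel LT_V u(3) flip: ennreal_mult')
    then show "u t l \<ge> 0" "conv kernel (V l) t = ennreal (u t l)"
      using laplace_unique_continuous[OF u(1,2)[OF l] hc _ nn t] by auto
  qed
  have phi: "set_integrable lebesgue {0<..} (\<lambda>\<tau>. \<phi> t \<tau> * exp (- l * \<tau>))"
      "(LINT \<tau>:{0<..}|lebesgue. \<phi> t \<tau> * exp (- l * \<tau>)) = u t l" if l: "l \<ge> 0" and t: "t > 0" for l t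
  proof -
    have "(\<integral>\<^sup>+\<tau>. indicator {0<..} \<tau> * (ennreal (exp (- l * \<tau>)) * inverse_density \<tau> t) \<partial>lborel)
        = LT (\<lambda>\<tau>. indicator {0<..} \<tau> * inverse_density \<tau> t) l"
      unfolding LT_def by (intro nn_integral_cong) (simp add: ac_simps)
    also have "\<dots> = ennreal (u t l)"
      using inverse_density_subordination[OF l V[OF l] LT_V[OF l]] conv_u[OF l t] by simp
    finally show "set_integrable lebesgue {0<..} (\<lambda>\<tau>. \<phi> t \<tau> * exp (- l * \<tau>))"
      "(LINT \<tau>:{0<..}|lebesgue. \<phi> t \<tau> * exp (- l * \<tau>)) = u t l"
      using set_integral_enn2real[of "\<lambda>\<tau>. ennreal (exp (- l * \<tau>)) * inverse_density \<tau> t" "u t l"] conv_u(1)[OF l t]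
      unfolding \<phi>_def by (simp_all add: enn2real_mult mult.commute)
  qed
  have psi: "set_integrable lebesgue {0<..} (\<lambda>\<tau>. \<psi> t \<tau> * exp (- l * \<tau>))"
      "(LINT \<tau>:{0<..}|lebesgue. \<psi> t \<tau> * exp (- l * \<tau>)) = v t l" if l: "l \<ge> 0" and t: "t > 0" for l t
  proof -
    have "(\<integral>\<^sup>+\<tau>. indicator {0<..} \<tau> * (ennreal (exp (- l * \<tau>)) * subordinator_density \<tau> t) \<partial>lborel)
        = LT (\<lambda>\<tau>. indicator {0<..} \<tau> * subordinator_density \<tau> t) l"
      unfolding LT_def by (intro nn_integral_cong) (simp add: ac_simps)
    also have "\<dots> = ennreal (v t l)"
      using subordinator_density_subordination[OF l V[OF l] LT_V[OF l] t] t
      by (simp add: V_def half_line_ennreal_def)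
    finally show "set_integrable lebesgue {0<..} (\<lambda>\<tau>. \<psi> t \<tau> * exp (- l * \<tau>))"
      "(LINT \<tau>:{0<..}|lebesgue. \<psi> t \<tau> * exp (- l * \<tau>)) = v t l"
      using set_integral_enn2real[of "\<lambda>\<tau>. ennreal (exp (- l * \<tau>)) * subordinator_density \<tau> t" "v t l"] v_nonneg[OF l t]
      unfolding \<psi>_def by (simp_all add: enn2real_mult mult.commute)
  qed
  \<comment> \<open>For \<open>\<lambda> = 0\<close> the transform of \<open>u\<close> is \<open>1 / s\<close>; this normalises \<open>\<phi>\<close>.\<close>
  have u0: "u t 0 = 1" if t: "t > 0" for t
  proof -
    have "half_line_continuous (indicator {0<..})"
      unfolding half_line_continuous_def
    proof (intro conjI)
      have "continuous_on {0<..} (indicator {0<..} :: real \<Rightarrow> ennreal) \<longleftrightarrow> continuous_on {0<..} (\<lambda>t::real. 1 :: ennreal)"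
        by (intro continuous_on_cong) auto
      then show "continuous_on {0<..} (indicator {0<..} :: real \<Rightarrow> ennreal)" by simp
    qed (auto simp: LT_step_Ioi indicator_def)
    moreover have "laplace (\<lambda>t. u t 0) s = 1 / s" if "s > 0" for s
      using u(3)[of 0 s] g_pos[OF that] that by simp
    ultimately have "u t 0 \<ge> 0" "indicator {0<..} t = ennreal (u t 0)"
      using laplace_unique_continuous[OF u(1,2)[of 0] _ _ _ t, of "indicator {0<..}"] by (auto simp: LT_step_Ioi)
    then show ?thesis using t by (simp add: ennreal_1[symmetric] del: ennreal_1)
  qed
  have psi1: "set_integrable lebesgue {0<..} (\<lambda>t. \<psi> t \<tau>)" "(LINT t:{0<..}|lebesgue. \<psi> t \<tau>) = 1"
    if "\<tau> > 0" for \<tau>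
  proof -
    have "(\<integral>\<^sup>+t. indicator {0<..} t * subordinator_density \<tau> t \<partial>lborel)
        = (\<integral>\<^sup>+t. subordinator_density \<tau> t \<partial>lborel)"
      by (intro nn_integral_cong) (auto simp: indicator_def subordinator_density_support)
    then have "(\<integral>\<^sup>+t. indicator {0<..} t * subordinator_density \<tau> t \<partial>lborel) = ennreal 1"
      using nn_integral_subordinator_density[OF that] by simp
    from set_integral_enn2real[OF _ this]
    show "set_integrable lebesgue {0<..} (\<lambda>t. \<psi> t \<tau>)" "(LINT t:{0<..}|lebesgue. \<psi> t \<tau>) = 1"
      unfolding \<psi>_def by auto
  qed
  show ?thesis
  proof (rule exI[of _ \<phi>], rule exI[of _ \<psi>], intro conjI allI impI)
    fix t :: real assume t: "t > 0"
    show "set_integrable lebesgue {0<..} (\<lambda>\<tau>. \<phi> t \<tau>)" "(LINT \<tau>:{0<..}|lebesgue. \<phi> t \<tau>) = 1"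
      using phi[of 0 t] u0[OF t] t by simp_all
    fix \<tau> :: real
    show "\<phi> t \<tau> \<ge> 0" "\<psi> t \<tau> \<ge> 0" unfolding \<phi>_def \<psi>_def by simp_all
  qed (use phi psi psi1 in simp_all)
qed

end
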